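(* Let $M^3$ be a 3-dimensional paracontact metric manifold with a paracontact metric structure $(\varphi,\xi,\eta,g)$ such that $\varphi Q=Q\varphi$, where $Q$ is the Ricci operator. Then the function $\mathrm{tr}\,l$ is constant everywhere on $M^3$, where $l$ is the operator $lX=R(X,\xi)\xi$.
   Context: An almost paracontact structure on a smooth $(2n+1)$-manifold $M$ is a triple $(\varphi,\xi,\eta)$ of a $(1,1)$-tensor field, a vector field and a 1-form with $\varphi\xi=0$, $\eta\circ\varphi=0$, $\eta(\xi)=1$, $\varphi^2=\mathrm{id}-\eta\otimes\xi$, and such that $\varphi$ induces an almost paracomplex structure on the distribution $\mathbb D=\ker\eta$ (its $\pm1$-eigendistributions in $\mathbb D$ have equal rank $n$). A compatible metric is a pseudo-Riemannian metric $g$ with $g(\varphi X,\varphi Y)=-g(X,Y)+\eta(X)\eta(Y)$; it has signature $(n+1,n)$ and $\eta(X)=g(X,\xi)$. The structure $(\varphi,\xi,\eta,g)$ is a paracontact metric structure, and $M$ a paracontact metric manifold, if in addition $g(X,\varphi Y)=d\eta(X,Y)$, where $d\eta(X,Y)=\frac12\big(X\eta(Y)-Y\eta(X)-\eta([X,Y])\big)$. Here $n=1$. Notation: $\nabla$ is the Levi-Civita connection of $g$; $R(X,Y)Z=\nabla_X\nabla_YZ-\nabla_Y\nabla_XZ-\nabla_{[X,Y]}Z$; $\mathrm{Ric}(Y,Z)$ is the trace of $X\mapsto R(X,Y)Z$ and $Q$ is defined by $g(QX,Y)=\mathrm{Ric}(X,Y)$; $\mathrm{tr}$ is the trace of an 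endomorphism.
   Formalization: The manifold M is assumed connected; otherwise tr l may take different constant values on different components (e.g. a disjoint union of a para-Sasakian piece with tr l = -2 and a flat piece with tr l = 0). *)

theory Defs
  imports "HOL-Analysis.Analysis" "HOL-Library.Function_Algebras"
begin

text \<open>Functions carry the pointwise real vector space structure. It is used for tangent vectors
  (derivations) and for vector fields.\<close>

instantiation "fun" :: (type, real_vector) real_vector
begin

definition scaleR_fun :: "real \<Rightarrow> ('a \<Rightarrow> 'b) \<Rightarrow> 'a \<Rightarrow> 'b"
  where "scaleR_fun c f = (\<lambda>x. c *\<^sub>R f x)"

instance
  by standard (auto simp: scaleR_fun_def fun_eq_iff scaleR_add_right scaleR_add_left)

end

definition linear_map_on :: "'v::real_vector set \<Rightarrow> ('v \<Rightarrow> 'w::real_vector) \<Rightarrow> bool"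
  where "linear_map_on V F \<longleftrightarrow>
    (\<forall>x\<in>V. \<forall>y\<in>V. F (x + y) = F x + F y) \<and> (\<forall>c. \<forall>x\<in>V. F (c *\<^sub>R x) = c *\<^sub>R F x)"

text \<open>Trace of an endomorphism of a finite-dimensional subspace; it does not depend on the basis.\<close>

definition trace_on :: "'v::real_vector set \<Rightarrow> ('v \<Rightarrow> 'v) \<Rightarrow> real"
  where "trace_on V F =
    (let B = (SOME B. independent B \<and> span B = V) in \<Sum>b\<in>B. representation B (F b) b)"


section \<open>Smooth manifolds\<close>

text \<open>\<open>Ck k S f\<close> is meant for open \<open>S\<close>.\<close>

primrec Ck :: "nat \<Rightarrow> 'e::euclidean_space set \<Rightarrow> ('e \<Rightarrow> 'f::real_normed_vector) \<Rightarrow> bool"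
  where
    "Ck 0 S f \<longleftrightarrow> continuous_on S f"
  | "Ck (Suc k) S f \<longleftrightarrow>
      f differentiable_on S \<and> (\<forall>v. Ck k S (\<lambda>x. frechet_derivative f (at x) v))"

definition C_infinity :: "'e::euclidean_space set \<Rightarrow> ('e \<Rightarrow> 'f::real_normed_vector) \<Rightarrow> bool"
  where "C_infinity S f \<longleftrightarrow> (\<forall>k. Ck k S f)"

type_synonym ('a, 'e) chart = "'a set \<times> ('a \<Rightarrow> 'e)"

definition is_chart :: "'a topology \<Rightarrow> ('a, 'e::euclidean_space) chart \<Rightarrow> bool"
  where "is_chart M c \<longleftrightarrow> (case c of (U, \<psi>) \<Rightarrow>
    openin M U \<and> open (\<psi> ` U) \<and>
    homeomorphic_map (subtopology M U) (top_of_set (\<psi> ` U)) \<psi>)"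

text \<open>The atlas need not be maximal: it determines the smooth structure.\<close>

definition smooth_manifold :: "'a topology \<Rightarrow> ('a, 'e::euclidean_space) chart set \<Rightarrow> bool"
  where "smooth_manifold M A \<longleftrightarrow>
    Hausdorff_space M \<and> second_countable M \<and>
    (\<forall>c\<in>A. is_chart M c) \<and>
    (\<Union>(U, \<psi>)\<in>A. U) = topspace M \<and>
    (\<forall>(U, \<psi>)\<in>A. \<forall>(V, \<theta>)\<in>A. C_infinity (\<psi> ` (U \<inter> V)) (\<theta> \<circ> inv_into U \<psi>))"

definition smooth_fun_on ::
  "'a topology \<Rightarrow> ('a, 'e::euclidean_space) chart set \<Rightarrow> 'a set \<Rightarrow> ('a \<Rightarrow> real) \<Rightarrow> bool"
  where "smooth_fun_on M A W f \<longleftrightarrow>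
    openin M W \<and> (\<forall>(U, \<psi>)\<in>A. C_infinity (\<psi> ` (U \<inter> W)) (f \<circ> inv_into U \<psi>))"

definition smooth_near ::
  "'a topology \<Rightarrow> ('a, 'e::euclidean_space) chart set \<Rightarrow> 'a \<Rightarrow> ('a \<Rightarrow> real) \<Rightarrow> bool"
  where "smooth_near M A p f \<longleftrightarrow> (\<exists>W. p \<in> W \<and> smooth_fun_on M A W f)"


section \<open>Tangent vectors and vector fields\<close>

text \<open>A tangent vector at \<open>p\<close> is a derivation on the functions that are smooth near \<open>p\<close>.
  It factors through germs at \<open>p\<close>: if \<open>f\<close> and \<open>f'\<close> agree on a neighbourhood of \<open>p\<close>, multiply both by
  the indicator function of that neighbourhood, which is smooth near \<open>p\<close>. The
  value 0 on all other functions is a convention that makes equality of tangent vectors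
  extensional.\<close>

type_synonym 'a tvec = "('a \<Rightarrow> real) \<Rightarrow> real"

definition tangent_space ::
  "'a topology \<Rightarrow> ('a, 'e::euclidean_space) chart set \<Rightarrow> 'a \<Rightarrow> 'a tvec set"
  where "tangent_space M A p = {v.
    (\<forall>f h. smooth_near M A p f \<longrightarrow> smooth_near M A p h \<longrightarrow>
        v (\<lambda>q. f q + h q) = v f + v h \<and>
        v (\<lambda>q. f q * h q) = f p * v h + h p * v f) \<and>
    (\<forall>c f. smooth_near M A p f \<longrightarrow> v (\<lambda>q. c * f q) = c * v f) \<and>
    (\<forall>f. \<not> smooth_near M A p f \<longrightarrow> v f = 0)}"

text \<open>Vector fields and connections are defined over every open subset of the manifold; values
  outside the open set in question are irrelevant.\<close>

type_synonym 'a vfield = "'a \<Rightarrow> 'a tvec"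

definition vector_field_on ::
  "'a topology \<Rightarrow> ('a, 'e::euclidean_space) chart set \<Rightarrow> 'a set \<Rightarrow> 'a vfield \<Rightarrow> bool"
  where "vector_field_on M A W X \<longleftrightarrow>
    openin M W \<and> (\<forall>p\<in>W. X p \<in> tangent_space M A p) \<and>
    (\<forall>V f. V \<subseteq> W \<longrightarrow> smooth_fun_on M A V f \<longrightarrow> smooth_fun_on M A V (\<lambda>p. X p f))"

definition lie_bracket ::
  "'a topology \<Rightarrow> ('a, 'e::euclidean_space) chart set \<Rightarrow> 'a vfield \<Rightarrow> 'a vfield \<Rightarrow> 'a vfield"
  where "lie_bracket M A X Y = (\<lambda>p f.
    if smooth_near M A p f then X p (\<lambda>q. Y q f) - Y p (\<lambda>q. X q f) else 0)"


section \<open>Tensor fields\<close>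

definition one_form ::
  "'a topology \<Rightarrow> ('a, 'e::euclidean_space) chart set \<Rightarrow> ('a \<Rightarrow> 'a tvec \<Rightarrow> real) \<Rightarrow> bool"
  where "one_form M A \<eta> \<longleftrightarrow>
    (\<forall>p\<in>topspace M. linear_map_on (tangent_space M A p) (\<eta> p)) \<and>
    (\<forall>W X. vector_field_on M A W X \<longrightarrow> smooth_fun_on M A W (\<lambda>p. \<eta> p (X p)))"

definition endomorphism_field ::
  "'a topology \<Rightarrow> ('a, 'e::euclidean_space) chart set \<Rightarrow> ('a \<Rightarrow> 'a tvec \<Rightarrow> 'a tvec) \<Rightarrow> bool"
  where "endomorphism_field M A \<phi> \<longleftrightarrow>
    (\<forall>p\<in>topspace M. \<phi> p ` tangent_space M A p \<subseteq> tangent_space M A p \<and>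
        linear_map_on (tangent_space M A p) (\<phi> p)) \<and>
    (\<forall>W X. vector_field_on M A W X \<longrightarrow> vector_field_on M A W (\<lambda>p. \<phi> p (X p)))"

definition pseudo_riemannian_metric ::
  "'a topology \<Rightarrow> ('a, 'e::euclidean_space) chart set \<Rightarrow> ('a \<Rightarrow> 'a tvec \<Rightarrow> 'a tvec \<Rightarrow> real) \<Rightarrow> bool"
  where "pseudo_riemannian_metric M A g \<longleftrightarrow>
    (\<forall>p\<in>topspace M.
        (\<forall>x\<in>tangent_space M A p. linear_map_on (tangent_space M A p) (g p x)) \<and>
        (\<forall>x\<in>tangent_space M A p. \<forall>y\<in>tangent_space M A p. g p x y = g p y x) \<and>
        (\<forall>x\<in>tangent_space M A p. (\<forall>y\<in>tangent_space M A p. g p x y = 0) \<longrightarrow> x = 0)) \<and>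
    (\<forall>W X Y. vector_field_on M A W X \<longrightarrow> vector_field_on M A W Y \<longrightarrow>
        smooth_fun_on M A W (\<lambda>p. g p (X p) (Y p)))"

text \<open>The exterior derivative with the factor 1/2.\<close>

definition ext_deriv ::
  "'a topology \<Rightarrow> ('a, 'e::euclidean_space) chart set \<Rightarrow> ('a \<Rightarrow> 'a tvec \<Rightarrow> real) \<Rightarrow>
    'a vfield \<Rightarrow> 'a vfield \<Rightarrow> 'a \<Rightarrow> real"
  where "ext_deriv M A \<eta> X Y p =
    (X p (\<lambda>q. \<eta> q (Y q)) - Y p (\<lambda>q. \<eta> q (X q)) - \<eta> p (lie_bracket M A X Y p)) / 2"


section \<open>Paracontact metric structures\<close>

definition almost_paracontact ::
  "'a topology \<Rightarrow> ('a, 'e::euclidean_space) chart set \<Rightarrow> nat \<Rightarrow>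
    ('a \<Rightarrow> 'a tvec \<Rightarrow> 'a tvec) \<Rightarrow> 'a vfield \<Rightarrow> ('a \<Rightarrow> 'a tvec \<Rightarrow> real) \<Rightarrow> bool"
  where "almost_paracontact M A n \<phi> \<xi> \<eta> \<longleftrightarrow>
    DIM('e) = 2 * n + 1 \<and>
    endomorphism_field M A \<phi> \<and> vector_field_on M A (topspace M) \<xi> \<and> one_form M A \<eta> \<and>
    (\<forall>p\<in>topspace M.
        \<phi> p (\<xi> p) = 0 \<and> \<eta> p (\<xi> p) = 1 \<and>
        (\<forall>x\<in>tangent_space M A p. \<eta> p (\<phi> p x) = 0 \<and> \<phi> p (\<phi> p x) = x - \<eta> p x *\<^sub>R \<xi> p) \<and>
        dim {x \<in> tangent_space M A p. \<eta> p x = 0 \<and> \<phi> p x = x} = n \<and>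
        dim {x \<in> tangent_space M A p. \<eta> p x = 0 \<and> \<phi> p x = - x} = n)"

definition compatible_metric ::
  "'a topology \<Rightarrow> ('a, 'e::euclidean_space) chart set \<Rightarrow>
    ('a \<Rightarrow> 'a tvec \<Rightarrow> 'a tvec) \<Rightarrow> ('a \<Rightarrow> 'a tvec \<Rightarrow> real) \<Rightarrow>
    ('a \<Rightarrow> 'a tvec \<Rightarrow> 'a tvec \<Rightarrow> real) \<Rightarrow> bool"
  where "compatible_metric M A \<phi> \<eta> g \<longleftrightarrow>
    pseudo_riemannian_metric M A g \<and>
    (\<forall>p\<in>topspace M. \<forall>x\<in>tangent_space M A p. \<forall>y\<in>tangent_space M A p.
        g p (\<phi> p x) (\<phi> p y) = - g p x y + \<eta> p x * \<eta> p y)"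

definition paracontact_metric_structure ::
  "'a topology \<Rightarrow> ('a, 'e::euclidean_space) chart set \<Rightarrow> nat \<Rightarrow>
    ('a \<Rightarrow> 'a tvec \<Rightarrow> 'a tvec) \<Rightarrow> 'a vfield \<Rightarrow> ('a \<Rightarrow> 'a tvec \<Rightarrow> real) \<Rightarrow>
    ('a \<Rightarrow> 'a tvec \<Rightarrow> 'a tvec \<Rightarrow> real) \<Rightarrow> bool"
  where "paracontact_metric_structure M A n \<phi> \<xi> \<eta> g \<longleftrightarrow>
    almost_paracontact M A n \<phi> \<xi> \<eta> \<and> compatible_metric M A \<phi> \<eta> g \<and>
    (\<forall>W X Y. vector_field_on M A W X \<longrightarrow> vector_field_on M A W Y \<longrightarrow>
        (\<forall>p\<in>W. g p (X p) (\<phi> p (Y p)) = ext_deriv M A \<eta> X Y p))"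


section \<open>Levi-Civita connection and curvature\<close>

type_synonym 'a connection = "'a vfield \<Rightarrow> 'a vfield \<Rightarrow> 'a vfield"

text \<open>As for tangent vectors, locality follows from the product rules applied to indicator
  functions of smaller open sets.\<close>

definition affine_connection ::
  "'a topology \<Rightarrow> ('a, 'e::euclidean_space) chart set \<Rightarrow> 'a connection \<Rightarrow> bool"
  where "affine_connection M A nabla \<longleftrightarrow>
    (\<forall>W X Y. vector_field_on M A W X \<longrightarrow> vector_field_on M A W Y \<longrightarrow>
      vector_field_on M A W (nabla X Y) \<and>
      (\<forall>Z. vector_field_on M A W Z \<longrightarrow> (\<forall>p\<in>W.
          nabla (X + Z) Y p = nabla X Y p + nabla Z Y p \<and>
          nabla X (Y + Z) p = nabla X Y p + nabla X Z p)) \<and>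
      (\<forall>f. smooth_fun_on M A W f \<longrightarrow> (\<forall>p\<in>W.
          nabla (\<lambda>q. f q *\<^sub>R X q) Y p = f p *\<^sub>R nabla X Y p \<and>
          nabla X (\<lambda>q. f q *\<^sub>R Y q) p = X p f *\<^sub>R Y p + f p *\<^sub>R nabla X Y p)))"

definition levi_civita ::
  "'a topology \<Rightarrow> ('a, 'e::euclidean_space) chart set \<Rightarrow>
    ('a \<Rightarrow> 'a tvec \<Rightarrow> 'a tvec \<Rightarrow> real) \<Rightarrow> 'a connection \<Rightarrow> bool"
  where "levi_civita M A g nabla \<longleftrightarrow>
    affine_connection M A nabla \<and>
    (\<forall>W X Y. vector_field_on M A W X \<longrightarrow> vector_field_on M A W Y \<longrightarrow> (\<forall>p\<in>W.
        nabla X Y p - nabla Y X p = lie_bracket M A X Y p \<and>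
        (\<forall>Z. vector_field_on M A W Z \<longrightarrow>
          X p (\<lambda>q. g q (Y q) (Z q)) = g p (nabla X Y p) (Z p) + g p (Y p) (nabla X Z p))))"

definition curvature ::
  "'a topology \<Rightarrow> ('a, 'e::euclidean_space) chart set \<Rightarrow> 'a connection \<Rightarrow>
    'a vfield \<Rightarrow> 'a vfield \<Rightarrow> 'a vfield \<Rightarrow> 'a vfield"
  where "curvature M A nabla X Y Z =
    nabla X (nabla Y Z) - nabla Y (nabla X Z) - nabla (lie_bracket M A X Y) Z"

text \<open>The value at \<open>p\<close> of the curvature depends only on the values of the three
  vector fields at \<open>p\<close>.\<close>

definition curvature_at ::
  "'a topology \<Rightarrow> ('a, 'e::euclidean_space) chart set \<Rightarrow> 'a connection \<Rightarrow> 'a \<Rightarrow>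
    'a tvec \<Rightarrow> 'a tvec \<Rightarrow> 'a tvec \<Rightarrow> 'a tvec"
  where "curvature_at M A nabla p x y z = (THE w. \<exists>W X Y Z. p \<in> W \<and>
    vector_field_on M A W X \<and> vector_field_on M A W Y \<and> vector_field_on M A W Z \<and>
    X p = x \<and> Y p = y \<and> Z p = z \<and> w = curvature M A nabla X Y Z p)"

definition ricci ::
  "'a topology \<Rightarrow> ('a, 'e::euclidean_space) chart set \<Rightarrow> 'a connection \<Rightarrow> 'a \<Rightarrow>
    'a tvec \<Rightarrow> 'a tvec \<Rightarrow> real"
  where "ricci M A nabla p y z =
    trace_on (tangent_space M A p) (\<lambda>x. curvature_at M A nabla p x y z)"

definition ricci_operator ::
  "'a topology \<Rightarrow> ('a, 'e::euclidean_space) chart set \<Rightarrow>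
    ('a \<Rightarrow> 'a tvec \<Rightarrow> 'a tvec \<Rightarrow> real) \<Rightarrow> 'a connection \<Rightarrow> 'a \<Rightarrow> 'a tvec \<Rightarrow> 'a tvec"
  where "ricci_operator M A g nabla p x = (THE w. w \<in> tangent_space M A p \<and>
    (\<forall>y\<in>tangent_space M A p. g p w y = ricci M A nabla p x y))"

definition jacobi_operator ::
  "'a topology \<Rightarrow> ('a, 'e::euclidean_space) chart set \<Rightarrow> 'a connection \<Rightarrow> 'a vfield \<Rightarrow>
    'a \<Rightarrow> 'a tvec \<Rightarrow> 'a tvec"
  where "jacobi_operator M A nabla \<xi> p x = curvature_at M A nabla p x (\<xi> p) (\<xi> p)"

end

theory Submission
  imports Defs
begin

text \<open>In the null frame \<open>\<xi>, e, f\<close> with \<open>\<phi> e = e\<close>, \<open>\<phi> f = - f\<close>, \<open>g(e, f) = 1\<close>, the paracontact condition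
  and the Jacobi identity leave five connection coefficients, among them \<open>s = g(\<nabla>\<^sub>e \<xi>, e)\<close> and
  \<open>t = g(\<nabla>\<^sub>f \<xi>, f)\<close>, and \<open>tr l = - 2 (1 + s t)\<close>. Since \<open>Q\<close> commutes with \<open>\<phi>\<close>, the frame diagonalises
  \<open>Q\<close>, so six components of the Ricci tensor vanish. Four of these equations express \<open>\<xi> s\<close>, \<open>\<xi> t\<close>,
  \<open>f s\<close>, \<open>e t\<close> algebraically; comparing \<open>[\<xi>, f] s\<close> and \<open>[\<xi>, e] t\<close> with the other two yields
  \<open>t (e s)\<close> and \<open>s (f t)\<close>. Together they show that \<open>s t\<close> has zero derivative in every direction.\<close>

section \<open>Functions of class C^k\<close>

text \<open>On \<open>ker \<eta>\<close> the covariant derivative of \<open>\<xi>\<close> is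
  \<open>- \<phi>\<close> plus a symmetric operator that sends \<open>e\<close> to
  \<open>s f\<close> and \<open>f\<close> to \<open>t e\<close>. Its square is \<open>s t\<close>,
  so in this indefinite signature it can be diagonalisable, without real eigenvalues, or nilpotent,
  and its type may change from point to point. A frame of its eigenvectors would force a case
  distinction, whereas the eigenlines of \<open>\<phi>\<close> exist everywhere and vary smoothly.
  The adapted frame is unique up to replacing \<open>e, f\<close> by \<open>c e, f / c\<close>; then
  \<open>s\<close> is multiplied by \<open>c^2\<close> and \<open>t\<close> by \<open>c^-2\<close>,
  which singles out \<open>s t\<close> as the invariant quantity. Since \<open>s\<close> and
  \<open>t\<close> may vanish, nothing is divided by them: the product rule for
  \<open>e (s t)\<close> asks for \<open>t (e s)\<close> rather than \<open>e s\<close>, and this is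
  what the bracket delivers. A separate obstacle is that tangent vectors are arbitrary derivations,
  so that the dimension of a tangent space has to be bounded first; the ranks of the eigenspaces of
  \<open>\<phi>\<close> provide the bound.\<close>

lemma Ck_subset: "Ck k S f \<Longrightarrow> T \<subseteq> S \<Longrightarrow> Ck k T f"
  by (induction k arbitrary: f) (auto intro: continuous_on_subset differentiable_on_subset)

lemma Ck_SucD: "Ck (Suc k) S f \<Longrightarrow> Ck k S f"
  by (induction k arbitrary: f) (auto intro: differentiable_imp_continuous_on)

text \<open>Openness of \<open>S\<close> lets agreement of values pass to agreement of derivatives,
  at every order of the recursion.\<close>

lemma Ck_cong:
  assumes "open S" "\<And>x. x \<in> S \<Longrightarrow> f x = h x" "Ck k S f"
  shows "Ck k S h"
  using assms(2,3)
proof (induction k arbitrary: f h)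
  case 0
  then show ?case by (simp cong: continuous_on_cong_simp)
next
  case (Suc k)
  have d: "f differentiable (at x)" if "x \<in> S" for x
    using Suc.prems(2) assms(1) that by (simp add: differentiable_on_eq_differentiable_at)
  have eq: "frechet_derivative f (at x) = frechet_derivative h (at x)" if "x \<in> S" for x
    using frechet_derivative_transform_within_open[OF d[OF that] assms(1) that Suc.prems(1)] .
  have "Ck k S (\<lambda>x. frechet_derivative h (at x) v)" for v
    by (rule Suc.IH[of "\<lambda>x. frechet_derivative f (at x) v"]) (use Suc.prems(2) eq in simp_all)
  moreover have "h differentiable (at x)" if "x \<in> S" for x
  proof -
    obtain D where "(f has_derivative D) (at x)"
      using d \<open>x \<in> S\<close> unfolding differentiable_def by blast
    then have "(h has_derivative D) (at x)"
      by (rule has_derivative_transform_within_open[OF _ assms(1) that]) (use Suc.prems(1) in auto)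
    then show ?thesis by (auto simp: differentiable_def)
  qed
  ultimately show ?case
    using assms(1) by (simp add: differentiable_on_eq_differentiable_at)
qed

text \<open>Any derivative \<open>f'\<close> may be exhibited: at points of the open set
  \<open>S\<close> it is unique, so it agrees with the \<open>frechet_derivative\<close> in the
  recursion for \<open>Ck\<close>.\<close>

lemma Ck_Suc_intro:
  assumes "open S" "\<And>x. x \<in> S \<Longrightarrow> (f has_derivative f' x) (at x)" "\<And>v. Ck k S (\<lambda>x. f' x v)"
  shows "Ck (Suc k) S f"
proof -
  have "Ck k S (\<lambda>x. frechet_derivative f (at x) v)" for v
    by (rule Ck_cong[OF assms(1) _ assms(3)[of v]]) (simp add: frechet_derivative_at[OF assms(2), symmetric])
  then show ?thesis
    using assms(1,2) by (auto simp: differentiable_on_def differentiable_def intro: has_derivative_at_withinI)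
qed

lemma Ck_Suc_derivative:
  assumes "open S" "Ck (Suc k) S f" "x \<in> S"
  shows "(f has_derivative frechet_derivative f (at x)) (at x)"
  using assms by (metis Ck.simps(2) differentiable_on_eq_differentiable_at frechet_derivative_works)

lemma Ck_const: "Ck k S (\<lambda>x. c)"
proof (induction k arbitrary: c)
  case (Suc k)
  then show ?case by (simp add: frechet_derivative_const differentiable_on_def)
qed simp

lemma Ck_add:
  assumes "open S" "Ck k S f" "Ck k S h"
  shows "Ck k S (\<lambda>x. f x + h x)"
  using assms(2,3)
proof (induction k arbitrary: f h)
  case (Suc k)
  note D = Ck_Suc_derivative[OF assms(1)]
  show ?case
    by (rule Ck_Suc_intro[OF assms(1) has_derivative_add[OF D[OF Suc.prems(1)] D[OF Suc.prems(2)]]])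
      (use Suc in \<open>auto intro: Suc.IH\<close>)
qed (auto intro!: continuous_on_add continuous_on_mult continuous_on_inverse)

lemma Ck_sum:
  assumes "open S" "\<And>i. i \<in> I \<Longrightarrow> Ck k S (f i)"
  shows "Ck k S (\<lambda>x. \<Sum>i\<in>I. f i x)"
  using assms(2)
  by (induction I rule: infinite_finite_induct) (auto intro: Ck_const Ck_add[OF assms(1)])

lemma Ck_bounded_linear:
  assumes "open S" "bounded_linear L" "Ck k S f"
  shows "Ck k S (\<lambda>x. L (f x))"
  using assms(3)
proof (induction k arbitrary: f)
  case 0
  then show ?case
    using assms(2) by (simp add: bounded_linear.continuous_on)
next
  case (Suc k)
  show ?case
    by (rule Ck_Suc_intro[OF assms(1) bounded_linear.has_derivative[OF assms(2) Ck_Suc_derivative[OF assms(1) Suc.prems]]])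
      (use Suc in \<open>auto intro: Suc.IH\<close>)
qed

lemma Ck_mult:
  fixes f h :: "'e::euclidean_space \<Rightarrow> real"
  assumes "open S" "Ck k S f" "Ck k S h"
  shows "Ck k S (\<lambda>x. f x * h x)"
  using assms(2,3)
proof (induction k arbitrary: f h)
  case (Suc k)
  note D = Ck_Suc_derivative[OF assms(1)]
  show ?case
  proof (rule Ck_Suc_intro[OF assms(1) has_derivative_mult[OF D[OF Suc.prems(1)] D[OF Suc.prems(2)]]])
    fix v
    have "Ck k S (\<lambda>x. frechet_derivative f (at x) v)" "Ck k S (\<lambda>x. frechet_derivative h (at x) v)"
      using Suc.prems by simp_all
    then show "Ck k S (\<lambda>x. f x * frechet_derivative h (at x) v + frechet_derivative f (at x) v * h x)"
      using Ck_SucD[OF Suc.prems(1)] Ck_SucD[OF Suc.prems(2)] by (intro Ck_add[OF assms(1)] Suc.IH)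
  qed
qed (auto intro!: continuous_on_add continuous_on_mult continuous_on_inverse)

text \<open>The derivative of the reciprocal is built from the derivative of \<open>f\<close> and
  from the reciprocal itself, to which the induction hypothesis applies; hence \<open>f\<close>
  stays fixed in the induction.\<close>

lemma Ck_inverse:
  fixes f :: "'e::euclidean_space \<Rightarrow> real"
  assumes "open S" "Ck k S f" "\<And>x. x \<in> S \<Longrightarrow> f x \<noteq> 0"
  shows "Ck k S (\<lambda>x. inverse (f x))"
  using assms(2)
proof (induction k)
  case (Suc k)
  note D = Ck_Suc_derivative[OF assms(1) Suc.prems]
  have *: "((\<lambda>x. inverse (f x)) has_derivative
      (\<lambda>v. (- 1) * (frechet_derivative f (at x) v * (inverse (f x) * inverse (f x))))) (at x)" if "x \<in> S" for x
    using Deriv.has_derivative_inverse[OF assms(3)[OF that] D[OF that]] by (simp add: ac_simps)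
  show ?case
  proof (rule Ck_Suc_intro[OF assms(1) *])
    fix v
    have "Ck k S (\<lambda>x. frechet_derivative f (at x) v)"
      using Suc.prems by simp
    then show "Ck k S (\<lambda>x. (- 1) * (frechet_derivative f (at x) v * (inverse (f x) * inverse (f x))))"
      using Suc.IH[OF Ck_SucD[OF Suc.prems]] by (intro Ck_mult[OF assms(1)] Ck_const)
  qed
qed (use assms(3) in \<open>auto intro!: continuous_on_add continuous_on_mult continuous_on_inverse\<close>)

text \<open>The chain rule is written as a sum over \<open>Basis\<close>, so that the derivative
  becomes a sum of products of real functions: components of the derivative of \<open>h\<close>, and
  partial derivatives of \<open>f\<close> composed with \<open>h\<close>, which the induction
  hypothesis covers.\<close>

lemma Ck_compose:
  fixes f :: "'f::euclidean_space \<Rightarrow> real" and h :: "'e::euclidean_space \<Rightarrow> 'f"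
  assumes "open S" "open T" "h ` S \<subseteq> T" "Ck k T f" "Ck k S h"
  shows "Ck k S (\<lambda>x. f (h x))"
  using assms(4,5)
proof (induction k arbitrary: f)
  case 0
  then show ?case
    using assms(3) by (auto intro: continuous_on_compose2)
next
  case (Suc k)
  note Dh = Ck_Suc_derivative[OF assms(1) Suc.prems(2)]
    and Df = Ck_Suc_derivative[OF assms(2) Suc.prems(1)]
  have *: "((\<lambda>x. f (h x)) has_derivative (\<lambda>v. \<Sum>b\<in>Basis.
      (frechet_derivative h (at x) v \<bullet> b) * frechet_derivative f (at (h x)) b)) (at x)" if "x \<in> S" for x
  proof -
    have hx: "h x \<in> T" using that assms(3) by auto
    interpret L: bounded_linear "frechet_derivative f (at (h x))"
      using Df[OF hx] by (rule has_derivative_bounded_linear)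
    have repr: "frechet_derivative f (at (h x)) y = (\<Sum>b\<in>Basis. (y \<bullet> b) * frechet_derivative f (at (h x)) b)" for y
      using arg_cong[OF euclidean_representation[of y], of "frechet_derivative f (at (h x))"]
      by (simp add: L.sum L.scaleR)
    show ?thesis
      using diff_chain_at[OF Dh[OF that] Df[OF hx]] unfolding o_def repr[symmetric] .
  qed
  show ?case
  proof (rule Ck_Suc_intro[OF assms(1) *])
    fix v
    have "Ck k S (\<lambda>x. frechet_derivative f (at (h x)) b)" for b
      by (rule Suc.IH[OF _ Ck_SucD[OF Suc.prems(2)]]) (use Suc.prems(1) in simp)
    moreover have "Ck k S (\<lambda>x. frechet_derivative h (at x) v \<bullet> b)" for b
      by (rule Ck_bounded_linear[OF assms(1) bounded_linear_inner_left]) (use Suc.prems(2) in simp)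
    ultimately show "Ck k S (\<lambda>x. \<Sum>b\<in>Basis.
      (frechet_derivative h (at x) v \<bullet> b) * frechet_derivative f (at (h x)) b)"
      by (intro Ck_sum[OF assms(1)] Ck_mult[OF assms(1)])
  qed
qed

lemma C_infinity_derivative:
  assumes "C_infinity S f"
  shows "C_infinity S (\<lambda>x. frechet_derivative f (at x) v)"
  unfolding C_infinity_def
proof
  fix k
  have "Ck (Suc k) S f" using assms unfolding C_infinity_def ..
  then show "Ck k S (\<lambda>x. frechet_derivative f (at x) v)" by simp
qed

lemma C_infinity_differentiable:
  assumes "open S" "C_infinity S f" "x \<in> S"
  shows "(f has_derivative frechet_derivative f (at x)) (at x)"
proof -
  have "Ck (Suc 0) S f" using assms(2) unfolding C_infinity_def ..
  then show ?thesis using Ck_Suc_derivative assms(1,3) by blast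
qed

section \<open>Smooth functions and vector fields\<close>

locale smooth_mfd =
  fixes M :: "'a topology" and A :: "('a, 'e::euclidean_space) chart set"
  assumes smooth_manifold: "smooth_manifold M A"
begin

abbreviation "smooth \<equiv> smooth_fun_on M A"
abbreviation "vf \<equiv> vector_field_on M A"
abbreviation "tangent \<equiv> tangent_space M A"

lemma chart:
  assumes "(U, \<psi>) \<in> A"
  shows "openin M U" "U \<subseteq> topspace M" "open (\<psi> ` U)" "inj_on \<psi> U"
    "homeomorphic_map (subtopology M U) (top_of_set (\<psi> ` U)) \<psi>"
proof -
  have "is_chart M (U, \<psi>)"
    using smooth_manifold assms unfolding smooth_manifold_def by blast
  then show *: "openin M U" "open (\<psi> ` U)" "homeomorphic_map (subtopology M U) (top_of_set (\<psi> ` U)) \<psi>"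
    unfolding is_chart_def by auto
  show "U \<subseteq> topspace M" using *(1) by (rule openin_subset)
  then show "inj_on \<psi> U"
    using homeomorphic_imp_injective_map[OF *(3)] by (simp add: topspace_subtopology Int_absorb1)
qed

lemma chart_open_image:
  assumes "(U, \<psi>) \<in> A" "openin M W"
  shows "open (\<psi> ` (U \<inter> W))"
proof -
  have "openin (subtopology M U) (U \<inter> W)"
    using assms(2) by (auto simp: openin_subtopology)
  then have "openin (top_of_set (\<psi> ` U)) (\<psi> ` (U \<inter> W))"
    using homeomorphic_imp_open_map[OF chart(5)[OF assms(1)]] unfolding open_map_def by blast
  then show ?thesis
    using chart(3)[OF assms(1)] by (simp add: openin_open_eq)
qed

lemma chart_openin_preimage:
  assumes "(U, \<psi>) \<in> A" "open B"
  shows "openin M {q \<in> U. \<psi> q \<in> B}"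
proof -
  have "openin (subtopology M U) {q \<in> topspace (subtopology M U). \<psi> q \<in> \<psi> ` U \<inter> B}"
    by (rule openin_continuous_map_preimage[OF homeomorphic_imp_continuous_map[OF chart(5)[OF assms(1)]]])
      (use assms(2) in \<open>auto simp: openin_open\<close>)
  then have "openin M {q \<in> topspace (subtopology M U). \<psi> q \<in> \<psi> ` U \<inter> B}"
    using openin_trans_full chart(1)[OF assms(1)] by blast
  moreover have "{q \<in> topspace (subtopology M U). \<psi> q \<in> \<psi> ` U \<inter> B} = {q \<in> U. \<psi> q \<in> B}"
    using chart(2)[OF assms(1)] by auto
  ultimately show ?thesis by simp
qed

lemma chart_inv [simp]:
  assumes "(U, \<psi>) \<in> A" "q \<in> U"
  shows "inv_into U \<psi> (\<psi> q) = q"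
  using chart(4)[OF assms(1)] assms(2) by (rule inv_into_f_f)

lemma chart_at:
  assumes "p \<in> topspace M"
  obtains U \<psi> where "(U, \<psi>) \<in> A" "p \<in> U"
  using smooth_manifold assms unfolding smooth_manifold_def by blast

lemma transition:
  assumes "(U, \<psi>) \<in> A" "(V, \<theta>) \<in> A"
  shows "C_infinity (\<psi> ` (U \<inter> V)) (\<lambda>x. \<theta> (inv_into U \<psi> x))"
  using smooth_manifold assms unfolding smooth_manifold_def o_def by fast

lemma smoothI:
  assumes "openin M W"
    "\<And>U \<psi> k. (U, \<psi>) \<in> A \<Longrightarrow> Ck k (\<psi> ` (U \<inter> W)) (\<lambda>x. f (inv_into U \<psi> x))"
  shows "smooth W f"
  using assms unfolding smooth_fun_on_def C_infinity_def o_def by blast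

lemma smoothD:
  assumes "smooth W f" "(U, \<psi>) \<in> A"
  shows "Ck k (\<psi> ` (U \<inter> W)) (\<lambda>x. f (inv_into U \<psi> x))"
  using assms unfolding smooth_fun_on_def C_infinity_def o_def by blast

lemma smooth_openin: "smooth W f \<Longrightarrow> openin M W"
  unfolding smooth_fun_on_def by blast

lemma smooth_subset: "smooth W f \<Longrightarrow> openin M V \<Longrightarrow> V \<subseteq> W \<Longrightarrow> smooth V f"
  by (rule smoothI) (auto intro: Ck_subset smoothD)

lemma smooth_cong:
  assumes "smooth W f" "\<And>q. q \<in> W \<Longrightarrow> f q = h q"
  shows "smooth W h"
  using smooth_openin[OF assms(1)]
proof (rule smoothI)
  fix U \<psi> k assume c: "(U, \<psi>) \<in> A"
  show "Ck k (\<psi> ` (U \<inter> W)) (\<lambda>x. h (inv_into U \<psi> x))"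
    by (rule Ck_cong[OF chart_open_image[OF c smooth_openin[OF assms(1)]] _ smoothD[OF assms(1) c]])
      (use c assms(2) in auto)
qed

lemma smooth_const: "openin M W \<Longrightarrow> smooth W (\<lambda>q. c)"
  by (rule smoothI) (auto intro: Ck_const)

lemma smooth_add: "smooth W f \<Longrightarrow> smooth W h \<Longrightarrow> smooth W (\<lambda>q. f q + h q)"
  by (rule smoothI[OF smooth_openin], assumption)
    (rule Ck_add[OF chart_open_image]; (assumption | rule smoothD smooth_openin)+)

lemma smooth_mult: "smooth W f \<Longrightarrow> smooth W h \<Longrightarrow> smooth W (\<lambda>q. f q * h q)"
  by (rule smoothI[OF smooth_openin], assumption)
    (rule Ck_mult[OF chart_open_image]; (assumption | rule smoothD smooth_openin)+)

lemma smooth_cmult: "smooth W f \<Longrightarrow> smooth W (\<lambda>q. c * f q)"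
  by (intro smooth_mult smooth_const smooth_openin)

lemma smooth_minus: "smooth W f \<Longrightarrow> smooth W (\<lambda>q. - f q)"
  using smooth_cmult[of W f "-1"] by simp

lemma smooth_diff: "smooth W f \<Longrightarrow> smooth W h \<Longrightarrow> smooth W (\<lambda>q. f q - h q)"
  using smooth_add[of W f "\<lambda>q. - h q"] smooth_minus by simp

lemma smooth_inverse:
  assumes "smooth W f" "\<And>q. q \<in> W \<Longrightarrow> f q \<noteq> 0"
  shows "smooth W (\<lambda>q. inverse (f q))"
  using smooth_openin[OF assms(1)]
proof (rule smoothI)
  fix U \<psi> k assume c: "(U, \<psi>) \<in> A"
  show "Ck k (\<psi> ` (U \<inter> W)) (\<lambda>x. inverse (f (inv_into U \<psi> x)))"
    by (rule Ck_inverse[OF chart_open_image[OF c smooth_openin[OF assms(1)]] smoothD[OF assms(1) c]])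
      (use c assms(2) in auto)
qed

lemma smooth_indicator:
  assumes "openin M W"
  shows "smooth W (\<lambda>q. if q \<in> W then 1 else 0)"
  using smooth_const[OF assms, of 1] by (rule smooth_cong) simp

text \<open>Serves to shrink a domain until a metric coefficient can be inverted. Continuity is the
  case \<open>k = 0\<close> of smoothness and is available in a chart only, hence the restriction to
  \<open>U\<close>.\<close>

lemma openin_smooth_nonzero:
  assumes "smooth W f" "(U, \<psi>) \<in> A"
  shows "openin M {q \<in> U \<inter> W. f q \<noteq> 0}"
proof -
  define S where "S = \<psi> ` (U \<inter> W)"
  have S: "open S" unfolding S_def using assms chart_open_image smooth_openin by blast
  have "continuous_on S (\<lambda>x. f (inv_into U \<psi> x))"
    using smoothD[OF assms, of 0] unfolding S_def by simp
  then have "open (S \<inter> (\<lambda>x. f (inv_into U \<psi> x)) -` (- {0}))"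
    using S by (intro continuous_open_preimage) auto
  from openin_Int[OF smooth_openin[OF assms(1)] chart_openin_preimage[OF assms(2) this]]
  have "openin M (W \<inter> {q \<in> U. \<psi> q \<in> S \<and> f (inv_into U \<psi> (\<psi> q)) \<noteq> 0})" by simp
  moreover have "\<psi> q \<in> S" "f (inv_into U \<psi> (\<psi> q)) = f q" if "q \<in> U" "q \<in> W" for q
    using assms(2) that unfolding S_def by simp_all
  then have "W \<inter> {q \<in> U. \<psi> q \<in> S \<and> f (inv_into U \<psi> (\<psi> q)) \<noteq> 0} = {q \<in> U \<inter> W. f q \<noteq> 0}"
    by auto
  ultimately show ?thesis by simp
qed

section \<open>Tangent vectors as derivations\<close>

lemma smooth_near: "smooth W f \<Longrightarrow> p \<in> W \<Longrightarrow> smooth_near M A p f"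
  unfolding smooth_near_def by blast

lemma tangent_add:
  assumes "v \<in> tangent p" "smooth W f" "smooth W h" "p \<in> W"
  shows "v (\<lambda>q. f q + h q) = v f + v h"
  using assms smooth_near unfolding tangent_space_def by blast

lemma tangent_mult:
  assumes "v \<in> tangent p" "smooth W f" "smooth W h" "p \<in> W"
  shows "v (\<lambda>q. f q * h q) = f p * v h + h p * v f"
  using assms smooth_near unfolding tangent_space_def by blast

lemma tangent_cmult:
  assumes "v \<in> tangent p" "smooth W f" "p \<in> W"
  shows "v (\<lambda>q. c * f q) = c * v f"
  using assms smooth_near unfolding tangent_space_def by blast

lemma tangent_minus:
  assumes "v \<in> tangent p" "smooth W f" "p \<in> W"
  shows "v (\<lambda>q. - f q) = - v f"
  using tangent_cmult[OF assms, of "-1"] by simp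

lemma tangent_diff:
  assumes "v \<in> tangent p" "smooth W f" "smooth W h" "p \<in> W"
  shows "v (\<lambda>q. f q - h q) = v f - v h"
  using tangent_add[OF assms(1,2) smooth_minus[OF assms(3)] assms(4)]
    tangent_minus[OF assms(1,3,4)] by simp

lemma tangent_const:
  assumes "v \<in> tangent p" "p \<in> topspace M"
  shows "v (\<lambda>q. c) = 0"
proof -
  have 1: "smooth (topspace M) (\<lambda>q. 1)" by (simp add: smooth_const)
  have "v (\<lambda>q. 1) = 0" using tangent_mult[OF assms(1) 1 1 assms(2)] by simp
  then show ?thesis using tangent_cmult[OF assms(1) 1 assms(2), of c] by simp
qed

text \<open>The indicator \<open>i\<close> of \<open>W\<close> is idempotent with
  \<open>i p = 1\<close>, so the product rule gives \<open>v i = 2 * v i\<close>, that is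
  \<open>v i = 0\<close>. Multiplication by \<open>i\<close> thus leaves \<open>v\<close> unchanged
  and erases all values outside \<open>W\<close>.\<close>

lemma tangent_cong:
  assumes "v \<in> tangent p" "smooth W f" "p \<in> W" "\<And>q. q \<in> W \<Longrightarrow> f q = h q"
  shows "v f = v h"
proof -
  define i :: "'a \<Rightarrow> real" where "i = (\<lambda>q. if q \<in> W then 1 else 0)"
  have i: "smooth W i" unfolding i_def using assms(2) by (intro smooth_indicator smooth_openin)
  have ii: "(\<lambda>q. i q * i q) = i" and ip: "i p = 1" using assms(3) by (auto simp: i_def)
  have "v i = 0" using tangent_mult[OF assms(1) i i assms(3)] unfolding ii ip by simp
  then have *: "v (\<lambda>q. i q * f' q) = v f'" if "smooth W f'" for f'
    using tangent_mult[OF assms(1) i that assms(3)] ip by simp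
  have "(\<lambda>q. i q * f q) = (\<lambda>q. i q * h q)" using assms(4) by (auto simp: i_def)
  then show ?thesis using *[OF assms(2)] *[OF smooth_cong[OF assms(2,4)]] by simp
qed

lemma tangent_subspace: "subspace (tangent p)"
  unfolding subspace_def tangent_space_def
  by (auto simp: scaleR_fun_def algebra_simps)

section \<open>Vector fields as a module over the smooth functions\<close>

lemma vf_openin: "vf W X \<Longrightarrow> openin M W"
  unfolding vector_field_on_def by blast

lemma vf_topspace: "vf W X \<Longrightarrow> p \<in> W \<Longrightarrow> p \<in> topspace M"
  using vf_openin openin_subset by blast

lemma vf_tangent: "vf W X \<Longrightarrow> p \<in> W \<Longrightarrow> X p \<in> tangent p"
  unfolding vector_field_on_def by blast

lemma vf_smooth: "vf W X \<Longrightarrow> smooth W f \<Longrightarrow> smooth W (\<lambda>p. X p f)"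
  unfolding vector_field_on_def by blast

lemma vf_subset: "vf W X \<Longrightarrow> openin M V \<Longrightarrow> V \<subseteq> W \<Longrightarrow> vf V X"
  unfolding vector_field_on_def by blast

lemma vf_cong:
  assumes "vf W X" "\<And>q. q \<in> W \<Longrightarrow> X q = Y q"
  shows "vf W Y"
  unfolding vector_field_on_def
proof (intro conjI allI impI ballI)
  fix V f assume "V \<subseteq> W" "smooth V f"
  then have "smooth V (\<lambda>p. X p f)" using assms(1) unfolding vector_field_on_def by blast
  then show "smooth V (\<lambda>p. Y p f)"
    by (rule smooth_cong) (use assms(2) \<open>V \<subseteq> W\<close> in auto)
qed (use assms in \<open>auto simp: vf_openin dest: vf_tangent\<close>)

lemma vf_add:
  assumes "vf W X" "vf W Y"
  shows "vf W (\<lambda>q. X q + Y q)"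
  unfolding vector_field_on_def
proof (intro conjI allI impI ballI)
  fix p assume "p \<in> W"
  then show "X p + Y p \<in> tangent p"
    using assms by (intro subspace_add tangent_subspace vf_tangent)
next
  fix V f assume "V \<subseteq> W" "smooth V f"
  then have "smooth V (\<lambda>p. X p f + Y p f)" 
    using assms unfolding vector_field_on_def by (intro smooth_add) blast+
  then show "smooth V (\<lambda>p. (X p + Y p) f)" by simp
qed (use assms in \<open>auto simp: vf_openin\<close>)

lemma vf_scale:
  assumes "smooth W a" "vf W X"
  shows "vf W (\<lambda>q. a q *\<^sub>R X q)"
  unfolding vector_field_on_def
proof (intro conjI allI impI ballI)
  fix p assume "p \<in> W"
  then show "a p *\<^sub>R X p \<in> tangent p"
    using assms by (intro subspace_scale tangent_subspace vf_tangent)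
next
  fix V f assume *: "V \<subseteq> W" "smooth V f"
  then have "smooth V (\<lambda>p. X p f)"
    using assms unfolding vector_field_on_def by blast
  moreover have "smooth V a" using assms(1) smooth_openin[OF *(2)] *(1) by (rule smooth_subset)
  ultimately have "smooth V (\<lambda>p. a p * X p f)" by (intro smooth_mult)
  then show "smooth V (\<lambda>p. (a p *\<^sub>R X p) f)" by (simp add: scaleR_fun_def)
qed (use assms in \<open>auto simp: vf_openin\<close>)

lemma vf_cscale: "vf W X \<Longrightarrow> vf W (\<lambda>q. c *\<^sub>R X q)"
  by (intro vf_scale smooth_const vf_openin)

lemma vf_diff: "vf W X \<Longrightarrow> vf W Y \<Longrightarrow> vf W (\<lambda>q. X q - Y q)"
  using vf_add[of W X "\<lambda>q. (-1) *\<^sub>R Y q"] vf_cscale[of W Y "-1"] by simp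

subsection \<open>Coordinate vector fields\<close>

text \<open>The partial derivative in direction \<open>v\<close> in the chart \<open>c\<close>. The
  value 0 off the functions smooth near \<open>q\<close> follows the convention in
  \<open>tangent_space\<close>.\<close>

definition coordinate_field :: "'a set \<times> ('a \<Rightarrow> 'e) \<Rightarrow> 'e \<Rightarrow> 'a vfield"
  where "coordinate_field c v = (\<lambda>q f. if smooth_near M A q f
    then frechet_derivative (f \<circ> inv_into (fst c) (snd c)) (at (snd c q)) v else 0)"

lemma chart_has_derivative:
  assumes "(U, \<psi>) \<in> A" "smooth W f" "p \<in> U" "p \<in> W"
  shows "((f \<circ> inv_into U \<psi>) has_derivative frechet_derivative (f \<circ> inv_into U \<psi>) (at (\<psi> p))) (at (\<psi> p))"
  by (rule C_infinity_differentiable[OF chart_open_image[OF assms(1) smooth_openin[OF assms(2)]]])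
    (use assms in \<open>auto simp: smooth_fun_on_def\<close>)

lemma coordinate_field_vf:
  assumes c: "(U, \<psi>) \<in> A"
  shows "vf U (coordinate_field (U, \<psi>) v)"
  unfolding vector_field_on_def
proof (intro conjI allI impI ballI)
  show "openin M U" using c by (rule chart)
  let ?D = "\<lambda>f p. frechet_derivative (f \<circ> inv_into U \<psi>) (at (\<psi> p))"
  note D = chart_has_derivative[OF c]
  fix p assume p: "p \<in> U"
  have add: "?D (\<lambda>q. f q + h q) p v = ?D f p v + ?D h p v"
    and mult: "?D (\<lambda>q. f q * h q) p v = f p * ?D h p v + h p * ?D f p v"
    and cmult: "?D (\<lambda>q. b * f q) p v = b * ?D f p v"
    and near: "smooth_near M A p (\<lambda>q. f q + h q)" "smooth_near M A p (\<lambda>q. f q * h q)"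
      "smooth_near M A p (\<lambda>q. b * f q)"
    if f: "smooth_near M A p f" and h: "smooth_near M A p h" for f h b
  proof -
    obtain W where "smooth W f" "p \<in> W" using f unfolding smooth_near_def by blast
    moreover obtain V where "smooth V h" "p \<in> V" using h unfolding smooth_near_def by blast
    ultimately obtain W where W: "smooth W f" "smooth W h" "p \<in> W"
      by (meson IntI inf_le1 inf_le2 openin_Int smooth_openin smooth_subset)
    show "smooth_near M A p (\<lambda>q. f q + h q)" "smooth_near M A p (\<lambda>q. f q * h q)"
      "smooth_near M A p (\<lambda>q. b * f q)"
      using smooth_near[OF smooth_add[OF W(1,2)] W(3)] smooth_near[OF smooth_mult[OF W(1,2)] W(3)]
        smooth_near[OF smooth_cmult[OF W(1)] W(3)] by auto
    note Df = D[OF W(1) p W(3)] and Dh = D[OF W(2) p W(3)]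
    show "?D (\<lambda>q. f q + h q) p v = ?D f p v + ?D h p v"
      using frechet_derivative_at[OF has_derivative_add[OF Df Dh]] by (simp add: o_def fun_eq_iff)
    show "?D (\<lambda>q. f q * h q) p v = f p * ?D h p v + h p * ?D f p v"
      using frechet_derivative_at[OF has_derivative_mult[OF Df Dh]] c p by (simp add: o_def fun_eq_iff mult.commute)
    show "?D (\<lambda>q. b * f q) p v = b * ?D f p v"
      using frechet_derivative_at[OF has_derivative_mult_right[OF Df, of b]] by (simp add: o_def fun_eq_iff)
  qed
  show "coordinate_field (U, \<psi>) v p \<in> tangent p"
    unfolding tangent_space_def coordinate_field_def by (auto simp: add mult cmult near)
next
  fix V f assume V: "V \<subseteq> U" "smooth V f"
  define Df where "Df x = frechet_derivative (f \<circ> inv_into U \<psi>) (at x) v" for x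
  have oV: "openin M V" using V(2) by (rule smooth_openin)
  \<comment> \<open>Smoothness is tested in every chart of the atlas, while the partial derivative
    lives in \<open>\<psi>\<close>; a transition map is composed in between.\<close>
  have "smooth V (\<lambda>p. Df (\<psi> p))"
    using oV
  proof (rule smoothI)
    fix U' \<psi>' k assume c': "(U', \<psi>') \<in> A"
    show "Ck k (\<psi>' ` (U' \<inter> V)) (\<lambda>x. Df (\<psi> (inv_into U' \<psi>' x)))"
    proof (rule Ck_compose[where f = Df and T = "\<psi> ` (U \<inter> V)"])
      show "open (\<psi>' ` (U' \<inter> V))" using c' oV by (rule chart_open_image)
      show "open (\<psi> ` (U \<inter> V))" using c oV by (rule chart_open_image)
      show "(\<lambda>x. \<psi> (inv_into U' \<psi>' x)) ` \<psi>' ` (U' \<inter> V) \<subseteq> \<psi> ` (U \<inter> V)"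
        using V(1) c' by auto
      show "Ck k (\<psi> ` (U \<inter> V)) Df"
        using V(2) c C_infinity_derivative unfolding smooth_fun_on_def Df_def C_infinity_def by fast
      show "Ck k (\<psi>' ` (U' \<inter> V)) (\<lambda>x. \<psi> (inv_into U' \<psi>' x))"
        using transition[OF c' c] V(1) unfolding C_infinity_def by (blast intro: Ck_subset)
    qed
  qed
  then show "smooth V (\<lambda>p. coordinate_field (U, \<psi>) v p f)"
    by (rule smooth_cong) (use V(2) in \<open>auto simp: coordinate_field_def Df_def dest: smooth_near\<close>)
qed

text \<open>The coordinate functions \<open>\<psi> q \<bullet> b\<close> are dual to these fields:
  their derivative along the field of \<open>v\<close> is \<open>v \<bullet> b\<close>. Hence
  \<open>v\<close> can be recovered from its field at \<open>p\<close>.\<close>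

lemma coordinate_field_independent:
  assumes c: "(U, \<psi>) \<in> A" and p: "p \<in> U"
  shows "independent ((\<lambda>v. coordinate_field (U, \<psi>) v p) ` Basis)"
    "card ((\<lambda>v. coordinate_field (U, \<psi>) v p) ` Basis) = DIM('e)"
proof -
  let ?d = "\<lambda>v. coordinate_field (U, \<psi>) v p"
  have x: "smooth U (\<lambda>q. \<psi> q \<bullet> b)" for b
    using chart(1)[OF c]
  proof (rule smoothI)
    fix U' \<psi>' k assume c': "(U', \<psi>') \<in> A"
    show "Ck k (\<psi>' ` (U' \<inter> U)) (\<lambda>x. \<psi> (inv_into U' \<psi>' x) \<bullet> b)"
      by (rule Ck_bounded_linear[OF chart_open_image[OF c' chart(1)[OF c]] bounded_linear_inner_left])
        (use transition[OF c' c] in \<open>auto simp: C_infinity_def\<close>)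
  qed
  have dx: "?d v (\<lambda>q. \<psi> q \<bullet> b) = v \<bullet> b" for v b
  proof -
    have "((\<lambda>x. x \<bullet> b) has_derivative (\<lambda>v. v \<bullet> b)) (at (\<psi> p))"
      by (rule bounded_linear_imp_has_derivative[OF bounded_linear_inner_left])
    then have "((\<lambda>q. \<psi> q \<bullet> b) \<circ> inv_into U \<psi> has_derivative (\<lambda>v. v \<bullet> b)) (at (\<psi> p))"
      by (rule has_derivative_transform_within_open[OF _ chart(3)[OF c]]) (use c p in auto)
    then show ?thesis
      using smooth_near[OF x p] unfolding coordinate_field_def
      by (simp add: frechet_derivative_at[symmetric])
  qed
  have "linear ?d"
  proof (rule linearI; rule ext)
    fix v w :: 'e and r :: real and f
    have "bounded_linear (frechet_derivative (f \<circ> inv_into U \<psi>) (at (\<psi> p)))" if near: "smooth_near M A p f"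
    proof -
      obtain W where "smooth W f" "p \<in> W" using near unfolding smooth_near_def by blast
      then show ?thesis using chart_has_derivative[OF c _ p] has_derivative_bounded_linear by blast
    qed
    then show "?d (v + w) f = (?d v + ?d w) f" "?d (r *\<^sub>R v) f = (r *\<^sub>R ?d v) f"
      by (auto simp: coordinate_field_def scaleR_fun_def linear_simps)
  qed
  moreover have inj: "inj ?d"
  proof (rule injI)
    fix v w assume "?d v = ?d w"
    then have "v \<bullet> b = w \<bullet> b" for b using dx by metis
    then show "v = w" using euclidean_eq_iff[of v w] by blast
  qed
  ultimately show "independent (?d ` Basis)"
    using linear_independent_injective_image[OF _ independent_Basis] inj_on_subset[OF inj subset_UNIV] by blast
  show "card (?d ` Basis) = DIM('e)"
    by (rule card_image[OF inj_on_subset[OF inj subset_UNIV]])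
qed

text \<open>A counting argument in place of a Taylor expansion: the \<open>DIM('e)\<close>
  coordinate vectors are independent, so they span any space of at most that dimension. For the
  tangent space the bound is supplied by \<open>tangent_span\<close>.\<close>

lemma coordinate_field_span:
  assumes "(U, \<psi>) \<in> A" "p \<in> U" "tangent p \<subseteq> span B" "finite B" "card B \<le> DIM('e)"
  shows "tangent p \<subseteq> span ((\<lambda>v. coordinate_field (U, \<psi>) v p) ` Basis)"
proof
  let ?S = "(\<lambda>v. coordinate_field (U, \<psi>) v p) ` Basis"
  note S = coordinate_field_independent[OF assms(1,2)]
  fix x assume x: "x \<in> tangent p"
  show "x \<in> span ?S"
  proof (rule ccontr)
    assume n: "x \<notin> span ?S"
    then have "independent (insert x ?S)" using S(1) by (simp add: independent_insert)
    moreover have "insert x ?S \<subseteq> span B"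
      using x assms(3) vf_tangent[OF coordinate_field_vf[OF assms(1)] assms(2)] by auto
    ultimately have "card (insert x ?S) \<le> card B"
      using independent_span_bound[OF assms(4)] by blast
    moreover have "x \<notin> ?S" using n by (metis span_base)
    ultimately show False using S(2) assms(5) by simp
  qed
qed

text \<open>In a chart all partial derivatives vanish, and a ball is convex, so the function is
  constant there.\<close>

lemma locally_constant:
  assumes f: "smooth W f" and p: "p \<in> W"
    and zero: "\<And>q v. q \<in> W \<Longrightarrow> v \<in> tangent q \<Longrightarrow> v f = 0"
  obtains V where "openin M V" "p \<in> V" "V \<subseteq> W" "\<And>q. q \<in> V \<Longrightarrow> f q = f p"
proof -
  have "p \<in> topspace M" using f p smooth_openin openin_subset by blast
  then obtain U \<psi> where c: "(U, \<psi>) \<in> A" "p \<in> U" by (rule chart_at)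
  let ?S = "\<psi> ` (U \<inter> W)"
  have "open ?S" using c(1) smooth_openin[OF f] by (rule chart_open_image)
  moreover have "\<psi> p \<in> ?S" using c(2) p by blast
  ultimately obtain r where r: "r > 0" "ball (\<psi> p) r \<subseteq> ?S"
    unfolding open_contains_ball by blast
  define V where "V = {q \<in> U. \<psi> q \<in> ball (\<psi> p) r} \<inter> W"
  show ?thesis
  proof (rule that)
    show "openin M V" unfolding V_def
      by (intro openin_Int chart_openin_preimage[OF c(1)] smooth_openin[OF f]) auto
    show "p \<in> V" "V \<subseteq> W" unfolding V_def using c p r by auto
    have D0: "((f \<circ> inv_into U \<psi>) has_derivative (\<lambda>v. 0)) (at x)" if x: "x \<in> ?S" for x
    proof -
      obtain q where q: "q \<in> U" "q \<in> W" "x = \<psi> q" using x by auto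
      have "frechet_derivative (f \<circ> inv_into U \<psi>) (at x) = (\<lambda>v. 0)"
      proof
        fix v
        show "frechet_derivative (f \<circ> inv_into U \<psi>) (at x) v = 0"
          using zero[OF q(2) vf_tangent[OF coordinate_field_vf[OF c(1)] q(1)], of v] smooth_near[OF f q(2)] q(3)
          by (simp add: coordinate_field_def)
      qed
      then show ?thesis
        using chart_has_derivative[OF c(1) f q(1,2)] q(3) by simp
    qed
    have "\<exists>k. \<forall>x\<in>ball (\<psi> p) r. (f \<circ> inv_into U \<psi>) x = k"
      by (rule has_derivative_zero_constant[OF convex_ball])
        (rule has_derivative_at_withinI[OF D0[OF subsetD[OF r(2)]]])
    then obtain k where k: "\<And>x. x \<in> ball (\<psi> p) r \<Longrightarrow> (f \<circ> inv_into U \<psi>) x = k"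
      by metis
    show "f q = f p" if "q \<in> V" for q
      using k[of "\<psi> q"] k[of "\<psi> p"] that c r(1) unfolding V_def by simp
  qed
qed

end

section \<open>Linear algebra\<close>

text \<open>\<open>dim\<close> is 0 when there is no finite basis, so the value 1 really yields a
  one-element basis, even inside an infinite-dimensional space of functions.\<close>

lemma dim_1_span:
  fixes S :: "'v::real_vector set"
  assumes "dim S = 1" "x \<in> S" "x \<noteq> 0"
  shows "S \<subseteq> span {x}"
proof -
  obtain B where B: "B \<subseteq> S" "independent B" "S \<subseteq> span B" "card B = 1"
    using basis_exists[of S] assms(1) by metis
  then obtain b where b: "B = {b}" by (meson card_1_singletonE)
  obtain k where k: "x = k *\<^sub>R b" using B(3) b assms(2) by (auto simp: span_singleton)
  with assms(3) have "b = (1/k) *\<^sub>R x" by auto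
  then have "b \<in> span {x}" by (metis span_base span_scale insertI1)
  then show ?thesis using B(3) b span_minimal[of "{b}" "span {x}"] by auto
qed

lemma dim_1_nonzero:
  fixes S :: "'v::real_vector set"
  assumes "dim S = 1"
  obtains x where "x \<in> S" "x \<noteq> 0"
proof -
  obtain B where B: "B \<subseteq> S" "independent B" "S \<subseteq> span B" "card B = 1"
    using basis_exists[of S] assms by metis
  then obtain b where b: "B = {b}" by (meson card_1_singletonE)
  show ?thesis using that[of b] B b dependent_zero[of B] by auto
qed

lemma combination_diff:
  fixes x y z :: "'v::real_vector"
  shows "(a *\<^sub>R x + b *\<^sub>R y + c *\<^sub>R z) - (a' *\<^sub>R x + b' *\<^sub>R y + c' *\<^sub>R z) =
    (a - a') *\<^sub>R x + (b - b') *\<^sub>R y + (c - c') *\<^sub>R z"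
  by (simp add: scaleR_diff_left)

text \<open>\<open>\<theta>\<close> gives the coordinates with respect to \<open>E\<close>.
  Expanding each vector of the chosen basis \<open>B\<close> through \<open>E\<close>, and then each
  \<open>F (E i)\<close> through \<open>B\<close>, matches the two sums after their order is
  exchanged. A trace hidden behind \<open>SOME\<close> thereby becomes computable in a
  frame.\<close>

lemma trace_on_eq:
  fixes V :: "'v::real_vector set" and E :: "'i \<Rightarrow> 'v"
  assumes V: "subspace V" and I: "finite I" and E: "\<And>i. i \<in> I \<Longrightarrow> E i \<in> V"
    and expand: "\<And>x. x \<in> V \<Longrightarrow> x = (\<Sum>i\<in>I. \<theta> i x *\<^sub>R E i)"
    and \<theta>: "\<And>i. i \<in> I \<Longrightarrow> linear_map_on V (\<theta> i)"
    and F: "linear_map_on V F" "\<And>x. x \<in> V \<Longrightarrow> F x \<in> V"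
  shows "trace_on V F = (\<Sum>i\<in>I. \<theta> i (F (E i)))"
proof -
  define B where "B = (SOME B. independent B \<and> span B = V)"
  have "\<exists>B. independent B \<and> span B = V"
    using maximal_independent_subset[of V] V
    by (metis span_minimal subset_antisym)
  then have B: "independent B" "span B = V" unfolding B_def by (metis (mono_tags, lifting) someI_ex)+
  have "V \<subseteq> span (E ` I)"
    using expand by (metis (no_types, lifting) imageI span_base span_scale span_sum subsetI)
  then have fB: "finite B"
    using independent_span_bound[OF finite_imageI[OF I] B(1)] B(2) span_superset by blast
  have lin: "L (\<Sum>j\<in>J. c j *\<^sub>R x j) = (\<Sum>j\<in>J. c j *\<^sub>R L (x j))"
    if L: "linear_map_on V L" and x: "\<And>j. j \<in> J \<Longrightarrow> x j \<in> V" and J: "finite J"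
    for L :: "'v \<Rightarrow> 'w::real_vector" and J :: "'j set" and c x
    using J x
  proof (induction J rule: finite_induct)
    case empty
    have "L (0 *\<^sub>R 0) = 0 *\<^sub>R L 0" using L subspace_0[OF V] unfolding linear_map_on_def by blast
    then show ?case by simp
  next
    case (insert j J)
    have "(\<Sum>j\<in>J. c j *\<^sub>R x j) \<in> V" "c j *\<^sub>R x j \<in> V"
      using insert.prems by (auto intro!: subspace_sum subspace_scale V)
    then show ?case
      using insert L unfolding linear_map_on_def by simp
  qed
  have rep: "linear_map_on V (\<lambda>x. representation B x b)" for b
    unfolding linear_map_on_def B(2)[symmetric]
    by (simp add: representation_add[OF B(1)] representation_scale[OF B(1)])
  have "trace_on V F = (\<Sum>b\<in>B. representation B (F b) b)"
    unfolding trace_on_def B_def[symmetric] by simp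
  also have "\<dots> = (\<Sum>b\<in>B. \<Sum>i\<in>I. \<theta> i b * representation B (F (E i)) b)"
  proof (rule sum.cong[OF refl])
    fix b assume "b \<in> B"
    then have b: "b \<in> V" using B(2) span_base by blast
    have "F b = (\<Sum>i\<in>I. \<theta> i b *\<^sub>R F (E i))"
      using arg_cong[OF expand[OF b], of F] lin[OF F(1) E I, of "\<lambda>i. i"] by simp
    then show "representation B (F b) b = (\<Sum>i\<in>I. \<theta> i b * representation B (F (E i)) b)"
      using lin[OF rep[of b] F(2)[OF E] I, of "\<lambda>i. i"] by simp
  qed
  also have "\<dots> = (\<Sum>i\<in>I. \<Sum>b\<in>B. representation B (F (E i)) b *\<^sub>R \<theta> i b)"
    by (subst sum.swap) (simp add: mult.commute)
  also have "\<dots> = (\<Sum>i\<in>I. \<theta> i (F (E i)))"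
  proof (rule sum.cong[OF refl])
    fix i assume i: "i \<in> I"
    have "F (E i) = (\<Sum>b\<in>B. representation B (F (E i)) b *\<^sub>R b)"
      using sum_representation_eq[OF B(1) _ fB subset_refl] F(2)[OF E[OF i]] B(2) by metis
    moreover have "\<theta> i (\<Sum>b\<in>B. representation B (F (E i)) b *\<^sub>R b)
        = (\<Sum>b\<in>B. representation B (F (E i)) b *\<^sub>R \<theta> i b)"
      using lin[OF \<theta>[OF i] _ fB, of "\<lambda>b. b"] B(2) span_base by blast
    ultimately show "(\<Sum>b\<in>B. representation B (F (E i)) b *\<^sub>R \<theta> i b) = \<theta> i (F (E i))" by simp
  qed
  finally show ?thesis .
qed

section \<open>Lie brackets, connection and curvature\<close>

context smooth_mfd
begin

lemma lie_bracket_apply: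
  assumes "smooth W f" "p \<in> W"
  shows "lie_bracket M A X Y p f = X p (\<lambda>q. Y q f) - Y p (\<lambda>q. X q f)"
  using smooth_near[OF assms] by (simp add: lie_bracket_def)

text \<open>All third-order terms cancel. Care is needed only because a field at \<open>p\<close>
  sees an inner bracket through its values nearby, so everything is restricted to a set
  \<open>V\<close> on which \<open>f\<close> is smooth.\<close>

lemma lie_bracket_jacobi:
  assumes X: "vf W X" and Y: "vf W Y" and Z: "vf W Z" and p: "p \<in> W"
  shows "lie_bracket M A X (lie_bracket M A Y Z) p =
    lie_bracket M A (lie_bracket M A X Y) Z p + lie_bracket M A Y (lie_bracket M A X Z) p"
proof
  fix f
  show "lie_bracket M A X (lie_bracket M A Y Z) p f =
    (lie_bracket M A (lie_bracket M A X Y) Z p + lie_bracket M A Y (lie_bracket M A X Z) p) f"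
  proof (cases "smooth_near M A p f")
    case True
    then obtain V' where V': "smooth V' f" "p \<in> V'" unfolding smooth_near_def by blast
    define V where "V = V' \<inter> W"
    have oV: "openin M V" unfolding V_def
      using V'(1) X by (intro openin_Int smooth_openin vf_openin)
    have V: "smooth V f" "p \<in> V" "vf V X" "vf V Y" "vf V Z"
      using smooth_subset[OF V'(1) oV] vf_subset[OF _ oV] X Y Z V'(2) p unfolding V_def by auto
    have *: "B p (\<lambda>q. lie_bracket M A C D q f) = B p (\<lambda>q. C q (\<lambda>r. D r f)) - B p (\<lambda>q. D q (\<lambda>r. C r f))"
      if B: "vf V B" and C: "vf V C" and D: "vf V D" for B C D
    proof -
      note s = vf_smooth[OF C vf_smooth[OF D V(1)]] vf_smooth[OF D vf_smooth[OF C V(1)]]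
      have "B p (\<lambda>q. lie_bracket M A C D q f) = B p (\<lambda>q. C q (\<lambda>r. D r f) - D q (\<lambda>r. C r f))"
        using lie_bracket_apply[OF V(1)]
        by (intro tangent_cong[OF vf_tangent[OF B V(2)] smooth_diff[OF s] V(2), symmetric]) simp
      then show ?thesis
        using tangent_diff[OF vf_tangent[OF B V(2)] s V(2)] by simp
    qed
    show ?thesis
      using V by (simp add: lie_bracket_apply[of V] * vf_smooth)
  qed (simp add: lie_bracket_def)
qed

end

locale levi_civita_manifold = smooth_mfd M A
  for M :: "'a topology" and A :: "('a, 'e::euclidean_space) chart set" +
  fixes g :: "'a \<Rightarrow> 'a tvec \<Rightarrow> 'a tvec \<Rightarrow> real" and nabla :: "'a connection"
  assumes metric: "pseudo_riemannian_metric M A g"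
    and levi_civita: "levi_civita M A g nabla"
begin

abbreviation "bracket \<equiv> lie_bracket M A"

lemma g_linear:
  assumes "p \<in> topspace M" "x \<in> tangent p" "y \<in> tangent p"
  shows g_commute: "g p x y = g p y x"
    and g_add_right: "z \<in> tangent p \<Longrightarrow> g p x (y + z) = g p x y + g p x z"
    and g_add_left: "z \<in> tangent p \<Longrightarrow> g p (y + z) x = g p y x + g p z x"
    and g_scale_right: "g p x (c *\<^sub>R y) = c * g p x y"
    and g_scale_left: "g p (c *\<^sub>R y) x = c * g p y x"
    and g_diff_left: "z \<in> tangent p \<Longrightarrow> g p (y - z) x = g p y x - g p z x"
    and g_minus_right: "g p x (- y) = - g p x y"
    and g_minus_left: "g p (- y) x = - g p y x"
proof -
  have sym: "g p u x = g p x u" if "u \<in> tangent p" for u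
    using that metric assms(1,2) unfolding pseudo_riemannian_metric_def by blast
  have add: "g p x (u + v) = g p x u + g p x v" and scale: "g p x (b *\<^sub>R u) = b * g p x u"
    if "u \<in> tangent p" "v \<in> tangent p" for u v b
    using that metric assms(1,2) unfolding pseudo_riemannian_metric_def linear_map_on_def
    by (blast, metis real_scaleR_def)
  note sub = subspace_add[OF tangent_subspace] subspace_scale[OF tangent_subspace]
    subspace_diff[OF tangent_subspace] subspace_neg[OF tangent_subspace]
  have minus: "g p x (- u) = - g p x u" if "u \<in> tangent p" for u
    using scale[OF that that, of "-1"] by simp
  have diff: "g p x (u - v) = g p x u - g p x v" if "u \<in> tangent p" "v \<in> tangent p" for u v
    using add[OF that(1) sub(4)[OF that(2)]] minus[OF that(2)] by simp
  show "g p x y = g p y x" using sym[OF assms(3)] by simp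
  show "z \<in> tangent p \<Longrightarrow> g p x (y + z) = g p x y + g p x z"
    and "g p x (c *\<^sub>R y) = c * g p x y"
    and "g p x (- y) = - g p x y"
    using add scale minus assms(3) by blast+
  show "z \<in> tangent p \<Longrightarrow> g p (y + z) x = g p y x + g p z x"
    and "g p (c *\<^sub>R y) x = c * g p y x"
    and "z \<in> tangent p \<Longrightarrow> g p (y - z) x = g p y x - g p z x"
    and "g p (- y) x = - g p y x"
    using add scale diff minus assms(3) sym sub by simp_all
qed

lemma g_eqI:
  assumes "p \<in> topspace M" "x \<in> tangent p" "y \<in> tangent p"
    "\<And>z. z \<in> tangent p \<Longrightarrow> g p x z = g p y z"
  shows "x = y"
proof -
  have "x - y \<in> tangent p" using assms(2,3) by (rule subspace_diff[OF tangent_subspace])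
  moreover have "g p (x - y) z = 0" if "z \<in> tangent p" for z
    using g_diff_left[OF assms(1) that assms(2,3)] assms(4)[OF that] by simp
  ultimately have "x - y = 0"
    using metric assms(1) unfolding pseudo_riemannian_metric_def by blast
  then show ?thesis by simp
qed

lemmas g_smooth = metric[unfolded pseudo_riemannian_metric_def, THEN conjunct2, rule_format]

lemma affine: "affine_connection M A nabla"
  using levi_civita unfolding levi_civita_def by blast

lemmas connection = affine[unfolded affine_connection_def, rule_format]
lemmas levi_civitaD = levi_civita[unfolded levi_civita_def, THEN conjunct2, rule_format]

lemmas nabla_vf = connection[THEN conjunct1]

lemmas nabla_add = connection[THEN conjunct2, THEN conjunct1, rule_format]

lemmas nabla_scale = connection[THEN conjunct2, THEN conjunct2, rule_format]

lemma nabla_add_left: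
  assumes "vf W X" "vf W X'" "vf W Y" "p \<in> W"
  shows "nabla (\<lambda>q. X q + X' q) Y p = nabla X Y p + nabla X' Y p"
  using nabla_add[OF assms(1,3,2,4), THEN conjunct1] unfolding plus_fun_def[of X X'] .

lemma nabla_add_right:
  assumes "vf W X" "vf W Y" "vf W Y'" "p \<in> W"
  shows "nabla X (\<lambda>q. Y q + Y' q) p = nabla X Y p + nabla X Y' p"
  using nabla_add[OF assms, THEN conjunct2] unfolding plus_fun_def[of Y Y'] .

lemmas nabla_scale_left = nabla_scale[THEN conjunct1]

lemmas nabla_scale_right = nabla_scale[THEN conjunct2]

lemma torsion_free:
  assumes "vf W X" "vf W Y" "p \<in> W"
  shows "bracket X Y p = nabla X Y p - nabla Y X p"
  using levi_civitaD[OF assms, THEN conjunct1] by (rule sym)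

lemma metric_compatible:
  assumes "vf W X" "vf W Y" "vf W Z" "p \<in> W"
  shows "X p (\<lambda>q. g q (Y q) (Z q)) = g p (nabla X Y p) (Z p) + g p (Y p) (nabla X Z p)"
  using levi_civitaD[OF assms(1,2,4), THEN conjunct2] assms(3) by blast

text \<open>After multiplication by the indicator of \<open>W\<close> the two pairs of fields are
  equal as total functions. The multiplication does not change the value at \<open>p\<close>: the
  extra term in the product rule is the derivative of a function that is 1 near
  \<open>p\<close>.\<close>

lemma nabla_cong:
  assumes X: "vf W X" and Y: "vf W Y" and eq: "\<And>q. q \<in> W \<Longrightarrow> X q = X' q" "\<And>q. q \<in> W \<Longrightarrow> Y q = Y' q"
    and p: "p \<in> W"
  shows "nabla X Y p = nabla X' Y' p"
proof -
  define i :: "'a \<Rightarrow> real" where "i = (\<lambda>q. if q \<in> W then 1 else 0)"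
  have oW: "openin M W" using X by (rule vf_openin)
  have i: "smooth W i" unfolding i_def using oW by (rule smooth_indicator)
  have ip: "i p = 1" using p by (simp add: i_def)
  have *: "nabla (\<lambda>q. i q *\<^sub>R X1 q) (\<lambda>q. i q *\<^sub>R Y1 q) p = nabla X1 Y1 p" if X1: "vf W X1" and Y1: "vf W Y1" for X1 Y1
  proof -
    have "X1 p i = X1 p (\<lambda>q. 1)"
      by (rule tangent_cong[OF vf_tangent[OF X1 p] i p]) (simp add: i_def)
    then have "X1 p i = 0" using tangent_const[OF vf_tangent[OF X1 p] vf_topspace[OF X1 p]] by simp
    then show ?thesis
      using nabla_scale_left[OF X1 vf_scale[OF i Y1] i p] nabla_scale_right[OF X1 Y1 i p] ip by simp
  qed
  have "(\<lambda>q. i q *\<^sub>R X q) = (\<lambda>q. i q *\<^sub>R X' q)" "(\<lambda>q. i q *\<^sub>R Y q) = (\<lambda>q. i q *\<^sub>R Y' q)"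
    using eq by (auto simp: i_def)
  then show ?thesis
    using *[OF X Y] *[OF vf_cong[OF X eq(1)] vf_cong[OF Y eq(2)]] by simp
qed

text \<open>Smoothness of the bracket is read off from vanishing torsion, without a computation in
  coordinates.\<close>

lemma bracket_vf:
  assumes "vf W X" "vf W Y"
  shows "vf W (bracket X Y)"
  by (rule vf_cong[OF vf_diff[OF nabla_vf[OF assms] nabla_vf[OF assms(2,1)]]])
    (rule torsion_free[OF assms, symmetric])

section \<open>Symmetries and linearity of the curvature\<close>

lemma curvature_apply: "curvature M A nabla X Y Z p =
    nabla X (nabla Y Z) p - nabla Y (nabla X Z) p - nabla (bracket X Y) Z p"
  by (simp add: curvature_def)

lemma curvature_vf:
  assumes "vf W X" "vf W Y" "vf W Z"
  shows "vf W (curvature M A nabla X Y Z)"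
  by (rule vf_cong[OF vf_diff[OF vf_diff[OF nabla_vf[OF assms(1) nabla_vf[OF assms(2,3)]]
      nabla_vf[OF assms(2) nabla_vf[OF assms(1,3)]]] nabla_vf[OF bracket_vf[OF assms(1,2)] assms(3)]]])
    (rule curvature_apply[symmetric])

text \<open>Metric compatibility trades second covariant derivatives for derivatives of the
  functions \<open>g(\<nabla> Z, V)\<close>, which in a frame are the connection forms.\<close>

lemma curvature_metric:
  assumes "vf W X" "vf W Y" "vf W Z" "vf W V" "p \<in> W"
  shows "g p (curvature M A nabla X Y Z p) (V p) =
    X p (\<lambda>q. g q (nabla Y Z q) (V q)) - g p (nabla Y Z p) (nabla X V p)
    - Y p (\<lambda>q. g q (nabla X Z q) (V q)) + g p (nabla X Z p) (nabla Y V p)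
    - g p (nabla (bracket X Y) Z p) (V p)"
proof -
  note f = nabla_vf[OF assms(1) nabla_vf[OF assms(2,3)]] nabla_vf[OF assms(2) nabla_vf[OF assms(1,3)]]
    nabla_vf[OF bracket_vf[OF assms(1,2)] assms(3)]
  have "g p (curvature M A nabla X Y Z p) (V p) = g p (nabla X (nabla Y Z) p) (V p)
      - g p (nabla Y (nabla X Z) p) (V p) - g p (nabla (bracket X Y) Z p) (V p)"
    using vf_topspace[OF assms(1,5)] vf_tangent[OF _ assms(5)] f assms(4)
    by (simp add: curvature_apply g_diff_left subspace_diff[OF tangent_subspace])
  then show ?thesis
    using metric_compatible[OF assms(1) nabla_vf[OF assms(2,3)] assms(4,5)]
      metric_compatible[OF assms(2) nabla_vf[OF assms(1,3)] assms(4,5)] by simp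
qed

text \<open>The part symmetric in \<open>Z\<close> and \<open>V\<close> is the operator
  \<open>X Y - Y X - [X, Y]\<close> applied to the function \<open>g(Z, V)\<close>, hence
  zero.\<close>

lemma curvature_skew_metric:
  assumes "vf W X" "vf W Y" "vf W Z" "vf W V" "p \<in> W"
  shows "g p (curvature M A nabla X Y Z p) (V p) = - g p (curvature M A nabla X Y V p) (Z p)"
proof -
  have c: "g q (nabla B V q) (Z q) = B q (\<lambda>q. g q (Z q) (V q)) - g q (nabla B Z q) (V q)"
    if "vf W B" "q \<in> W" for B q
    using metric_compatible[OF that(1) assms(3,4) that(2)]
      g_commute[of q "nabla B V q" "Z q"] that assms vf_topspace vf_tangent nabla_vf by (smt (verit))
  have *: "B p (\<lambda>q. g q (nabla C V q) (Z q)) = B p (\<lambda>q. C q (\<lambda>q. g q (Z q) (V q))) - B p (\<lambda>q. g q (nabla C Z q) (V q))"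
    if B: "vf W B" and C: "vf W C" for B C
  proof -
    note s = vf_smooth[OF C g_smooth[OF assms(3,4)]] g_smooth[OF nabla_vf[OF C assms(3)] assms(4)]
    have "B p (\<lambda>q. g q (nabla C V q) (Z q)) = B p (\<lambda>q. C q (\<lambda>q. g q (Z q) (V q)) - g q (nabla C Z q) (V q))"
      by (rule tangent_cong[OF vf_tangent[OF B assms(5)] smooth_diff[OF s] assms(5), symmetric]) (use c[OF C] in simp)
    then show ?thesis using tangent_diff[OF vf_tangent[OF B assms(5)] s assms(5)] by simp
  qed
  have "g p (nabla Y V p) (nabla X Z p) = g p (nabla X Z p) (nabla Y V p)"
    "g p (nabla X V p) (nabla Y Z p) = g p (nabla Y Z p) (nabla X V p)"
    using assms by (meson g_commute nabla_vf vf_tangent vf_topspace)+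
  then show ?thesis
    using curvature_metric[OF assms] curvature_metric[OF assms(1,2,4,3,5)]
      *[OF assms(1,2)] *[OF assms(2,1)] c[OF bracket_vf[OF assms(1,2)] assms(5)]
      lie_bracket_apply[OF g_smooth[OF assms(3,4)] assms(5), of X Y] by simp
qed

lemma curvature_skew:
  assumes "vf W X" "vf W Y" "vf W Z" "p \<in> W"
  shows "curvature M A nabla X Y Z p = - curvature M A nabla Y X Z p"
proof -
  have o: "openin M W" using assms(1) by (rule vf_openin)
  have "nabla (bracket X Y) Z p = nabla (\<lambda>q. (-1) *\<^sub>R bracket Y X q) Z p"
    by (rule nabla_cong[OF bracket_vf[OF assms(1,2)] assms(3) _ refl assms(4)])
      (simp add: torsion_free[OF assms(1,2)] torsion_free[OF assms(2,1)])
  then show ?thesis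
    using nabla_scale_left[OF bracket_vf[OF assms(2,1)] assms(3) smooth_const[OF o, of "-1"] assms(4)]
    by (simp add: curvature_apply)
qed

lemma curvature_add:
  assumes "vf W X" "vf W X'" "vf W Y" "vf W Z" "p \<in> W"
  shows "curvature M A nabla (\<lambda>q. X q + X' q) Y Z p = curvature M A nabla X Y Z p + curvature M A nabla X' Y Z p"
proof -
  note s = vf_add[OF assms(1,2)]
  have "nabla Y (nabla (\<lambda>q. X q + X' q) Z) p = nabla Y (\<lambda>q. nabla X Z q + nabla X' Z q) p"
    by (rule nabla_cong[OF assms(3) nabla_vf[OF s assms(4)] refl _ assms(5)])
      (use nabla_add_left assms in blast)
  also have "\<dots> = nabla Y (nabla X Z) p + nabla Y (nabla X' Z) p"
    using assms by (intro nabla_add_right nabla_vf)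
  finally have 1: "nabla Y (nabla (\<lambda>q. X q + X' q) Z) p = nabla Y (nabla X Z) p + nabla Y (nabla X' Z) p" .
  have "nabla (bracket (\<lambda>q. X q + X' q) Y) Z p = nabla (\<lambda>q. bracket X Y q + bracket X' Y q) Z p"
    by (rule nabla_cong[OF bracket_vf[OF s assms(3)] assms(4) _ refl assms(5)])
      (simp add: torsion_free[of W] s assms nabla_add_left[of W] nabla_add_right[of W])
  also have "\<dots> = nabla (bracket X Y) Z p + nabla (bracket X' Y) Z p"
    using assms by (intro nabla_add_left bracket_vf)
  finally show ?thesis
    using nabla_add_left[OF assms(1,2) nabla_vf[OF assms(3,4)] assms(5)] 1 by (simp add: curvature_apply)
qed

text \<open>The term \<open>- Y(a) X\<close> of the bracket of \<open>a X\<close> with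
  \<open>Y\<close> cancels the term \<open>Y(a)\<close> from the product rule for the second
  covariant derivative.\<close>

lemma curvature_scale:
  assumes "vf W X" "vf W Y" "vf W Z" "smooth W a" "p \<in> W"
  shows "curvature M A nabla (\<lambda>q. a q *\<^sub>R X q) Y Z p = a p *\<^sub>R curvature M A nabla X Y Z p"
proof -
  note s = vf_scale[OF assms(4,1)] and a' = vf_smooth[OF assms(2,4)]
  have "nabla Y (nabla (\<lambda>q. a q *\<^sub>R X q) Z) p = nabla Y (\<lambda>q. a q *\<^sub>R nabla X Z q) p"
    by (rule nabla_cong[OF assms(2) nabla_vf[OF s assms(3)] refl _ assms(5)])
      (use nabla_scale_left assms in blast)
  also have "\<dots> = Y p a *\<^sub>R nabla X Z p + a p *\<^sub>R nabla Y (nabla X Z) p"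
    using assms by (intro nabla_scale_right nabla_vf)
  finally have 1: "nabla Y (nabla (\<lambda>q. a q *\<^sub>R X q) Z) p = Y p a *\<^sub>R nabla X Z p + a p *\<^sub>R nabla Y (nabla X Z) p" .
  have "nabla (bracket (\<lambda>q. a q *\<^sub>R X q) Y) Z p = nabla (\<lambda>q. a q *\<^sub>R bracket X Y q + (- Y q a) *\<^sub>R X q) Z p"
    by (rule nabla_cong[OF bracket_vf[OF s assms(2)] assms(3) _ refl assms(5)])
      (simp add: torsion_free[of W] s assms nabla_scale_left[of W] nabla_scale_right[of W] scaleR_diff_right)
  also have "\<dots> = a p *\<^sub>R nabla (bracket X Y) Z p + (- Y p a) *\<^sub>R nabla X Z p"
    using nabla_add_left[OF vf_scale[OF assms(4) bracket_vf[OF assms(1,2)]] vf_scale[OF smooth_minus[OF a'] assms(1)] assms(3,5)]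
      nabla_scale_left[OF bracket_vf[OF assms(1,2)] assms(3,4,5)]
      nabla_scale_left[OF assms(1,3) smooth_minus[OF a'] assms(5)] by simp
  finally show ?thesis
    using nabla_scale_left[OF assms(1) nabla_vf[OF assms(2,3)] assms(4,5)] 1
    by (simp add: curvature_apply scaleR_diff_right)
qed

end

context levi_civita_manifold
begin

abbreviation "R \<equiv> curvature M A nabla"

text \<open>The first slot suffices: frame expansions are made there, and the other two slots are
  reached through the skew symmetries.\<close>

lemma curvature_cong:
  assumes "vf W X" "vf W Y" "vf W Z" "p \<in> W" "\<And>q. q \<in> W \<Longrightarrow> X q = X' q"
  shows "R X Y Z p = R X' Y Z p"
proof -
  have X': "vf W X'" using assms(1,5) by (rule vf_cong)
  have 1: "nabla X B q = nabla X' B q" if "vf W B" "q \<in> W" for B q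
    by (rule nabla_cong[OF assms(1) that(1) assms(5) refl that(2)])
  have 2: "nabla B X q = nabla B X' q" if "vf W B" "q \<in> W" for B q
    by (rule nabla_cong[OF that(1) assms(1) refl assms(5) that(2)])
  have "nabla Y (nabla X Z) p = nabla Y (nabla X' Z) p"
    by (rule nabla_cong[OF assms(2) nabla_vf[OF assms(1,3)] refl 1[OF assms(3)] assms(4)])
  moreover have "nabla (bracket X Y) Z p = nabla (bracket X' Y) Z p"
    by (rule nabla_cong[OF bracket_vf[OF assms(1,2)] assms(3) _ refl assms(4)])
      (simp add: torsion_free[OF assms(1,2)] torsion_free[OF X' assms(2)] 1[OF assms(2)] 2[OF assms(2)])
  ultimately show ?thesis
    using 1[OF nabla_vf[OF assms(2,3)] assms(4)] by (simp add: curvature_apply)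
qed

end

section \<open>Paracontact metric manifolds of dimension three\<close>

locale paracontact = levi_civita_manifold M A g nabla
  for M :: "'a topology" and A :: "('a, 'e::euclidean_space) chart set" and g nabla +
  fixes \<phi> :: "'a \<Rightarrow> 'a tvec \<Rightarrow> 'a tvec" and \<xi> :: "'a vfield" and \<eta> :: "'a \<Rightarrow> 'a tvec \<Rightarrow> real"
  assumes paracontact: "paracontact_metric_structure M A 1 \<phi> \<xi> \<eta> g"
begin

lemma almost: "almost_paracontact M A 1 \<phi> \<xi> \<eta>" and compatible: "compatible_metric M A \<phi> \<eta> g"
  using paracontact unfolding paracontact_metric_structure_def by simp_all

lemma tensor_fields:
  "endomorphism_field M A \<phi>" "one_form M A \<eta>" "DIM('e) = 3" "vf (topspace M) \<xi>"
  using almost unfolding almost_paracontact_def by simp_all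

lemma xi_vf: "openin M W \<Longrightarrow> vf W \<xi>"
  by (rule vf_subset[OF tensor_fields(4) _ openin_subset])

lemmas phi_vf = tensor_fields(1)[unfolded endomorphism_field_def, THEN conjunct2, rule_format]

lemmas eta_smooth = tensor_fields(2)[unfolded one_form_def, THEN conjunct2, rule_format]

lemma xi_tangent: "p \<in> topspace M \<Longrightarrow> \<xi> p \<in> tangent p"
  using vf_tangent[OF xi_vf[OF openin_topspace]] .

lemma eta_linear:
  assumes "p \<in> topspace M" "x \<in> tangent p"
  shows eta_add: "y \<in> tangent p \<Longrightarrow> \<eta> p (x + y) = \<eta> p x + \<eta> p y"
    and eta_scale: "\<eta> p (c *\<^sub>R x) = c * \<eta> p x"
    and eta_minus: "\<eta> p (- x) = - \<eta> p x"
proof -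
  have L: "linear_map_on (tangent p) (\<eta> p)"
    using tensor_fields(2) assms(1) unfolding one_form_def by blast
  have scale: "\<eta> p (b *\<^sub>R z) = b *\<^sub>R \<eta> p z" if "z \<in> tangent p" for b z
    using L that unfolding linear_map_on_def by blast
  have add: "\<eta> p (x + z) = \<eta> p x + \<eta> p z" if "z \<in> tangent p" for z
    using L assms(2) that unfolding linear_map_on_def by blast
  show "y \<in> tangent p \<Longrightarrow> \<eta> p (x + y) = \<eta> p x + \<eta> p y" by (rule add)
  show "\<eta> p (c *\<^sub>R x) = c * \<eta> p x" "\<eta> p (- x) = - \<eta> p x"
    using scale[OF assms(2)] scale[OF assms(2), of "-1"] by simp_all
qed

lemma phi_linear:
  assumes "p \<in> topspace M" "x \<in> tangent p"
  shows phi_add: "y \<in> tangent p \<Longrightarrow> \<phi> p (x + y) = \<phi> p x + \<phi> p y"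
    and phi_scale: "\<phi> p (c *\<^sub>R x) = c *\<^sub>R \<phi> p x"
    and phi_diff: "y \<in> tangent p \<Longrightarrow> \<phi> p (x - y) = \<phi> p x - \<phi> p y"
proof -
  have L: "linear_map_on (tangent p) (\<phi> p)"
    using tensor_fields(1) assms(1) unfolding endomorphism_field_def by blast
  have scale: "\<phi> p (b *\<^sub>R z) = b *\<^sub>R \<phi> p z" if "z \<in> tangent p" for b z
    using L that unfolding linear_map_on_def by blast
  have add: "\<phi> p (x + z) = \<phi> p x + \<phi> p z" if "z \<in> tangent p" for z
    using L assms(2) that unfolding linear_map_on_def by blast
  show "y \<in> tangent p \<Longrightarrow> \<phi> p (x + y) = \<phi> p x + \<phi> p y" by (rule add)
  show "\<phi> p (c *\<^sub>R x) = c *\<^sub>R \<phi> p x"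
    by (rule scale[OF assms(2)])
  show "\<phi> p (x - y) = \<phi> p x - \<phi> p y" if "y \<in> tangent p"
    using add[OF subspace_neg[OF tangent_subspace that]] scale[OF that, of "-1"] by simp
qed

lemma phi_tangent: "p \<in> topspace M \<Longrightarrow> x \<in> tangent p \<Longrightarrow> \<phi> p x \<in> tangent p"
  using tensor_fields(1) unfolding endomorphism_field_def by blast

lemma almost_paracontact:
  assumes "p \<in> topspace M"
  shows phi_xi: "\<phi> p (\<xi> p) = 0" and eta_xi: "\<eta> p (\<xi> p) = 1"
    and eta_phi: "x \<in> tangent p \<Longrightarrow> \<eta> p (\<phi> p x) = 0"
    and phi_phi: "x \<in> tangent p \<Longrightarrow> \<phi> p (\<phi> p x) = x - \<eta> p x *\<^sub>R \<xi> p"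
    and dim_plus: "dim {x \<in> tangent p. \<eta> p x = 0 \<and> \<phi> p x = x} = 1"
    and dim_minus: "dim {x \<in> tangent p. \<eta> p x = 0 \<and> \<phi> p x = - x} = 1"
  using almost assms unfolding almost_paracontact_def by simp_all

lemma phi_compatible:
  assumes "p \<in> topspace M" "x \<in> tangent p" "y \<in> tangent p"
  shows "g p (\<phi> p x) (\<phi> p y) = - g p x y + \<eta> p x * \<eta> p y"
  using compatible assms unfolding compatible_metric_def by simp

text \<open>Compatibility with \<open>\<xi>\<close> in the second slot: since
  \<open>\<phi> \<xi> = 0\<close>, its left side vanishes, and
  \<open>\<eta> \<xi> = 1\<close>.\<close>

lemma g_xi:
  assumes "p \<in> topspace M" "x \<in> tangent p"
  shows "g p x (\<xi> p) = \<eta> p x" "g p (\<xi> p) x = \<eta> p x"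
proof -
  have "g p (\<phi> p x) (0 *\<^sub>R \<xi> p) = 0 * g p (\<phi> p x) (\<xi> p)"
    using assms by (intro g_scale_right phi_tangent xi_tangent)
  then show "g p x (\<xi> p) = \<eta> p x"
    using phi_compatible[OF assms xi_tangent[OF assms(1)]] assms(1) by (simp add: phi_xi eta_xi)
  then show "g p (\<xi> p) x = \<eta> p x" using g_commute[OF assms xi_tangent[OF assms(1)]] assms by simp
qed

lemma g_phi_skew:
  assumes p: "p \<in> topspace M" and x: "x \<in> tangent p" and y: "y \<in> tangent p"
  shows "g p (\<phi> p x) y = - g p x (\<phi> p y)"
proof -
  note t = phi_tangent[OF p x] phi_tangent[OF p y] xi_tangent[OF p]
  have "g p (\<phi> p (\<phi> p x)) (\<phi> p y) = g p x (\<phi> p y) - \<eta> p x * g p (\<xi> p) (\<phi> p y)"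
    using p x t by (simp add: phi_phi g_diff_left g_scale_left subspace_scale[OF tangent_subspace])
  then show ?thesis
    using phi_compatible[OF p t(1) y] p x y t by (simp add: g_xi eta_phi)
qed

text \<open>A skew operator has isotropic eigenspaces for nonzero eigenvalues. This is what makes
  the adapted frame null.\<close>

lemma g_eigenvectors:
  assumes "p \<in> topspace M" "x \<in> tangent p" "y \<in> tangent p"
  shows "\<phi> p x = x \<Longrightarrow> \<phi> p y = y \<Longrightarrow> g p x y = 0"
    and "\<phi> p x = - x \<Longrightarrow> \<phi> p y = - y \<Longrightarrow> g p x y = 0"
  using g_phi_skew[OF assms] g_minus_left[OF assms(1,3,2)] g_minus_right[OF assms] by simp_all

lemma eta_eigenvector:
  assumes "p \<in> topspace M" "x \<in> tangent p" "\<phi> p x = x \<or> \<phi> p x = - x"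
  shows "\<eta> p x = 0"
  using eta_phi[OF assms(1,2)] eta_minus[OF assms(1,2)] assms(3) by auto

text \<open>The paracontact condition solved for the bracket; the factor 2 undoes the 1/2 in
  \<open>ext_deriv\<close>.\<close>

lemma eta_bracket:
  assumes "vf W X" "vf W Y" "p \<in> W"
  shows "\<eta> p (bracket X Y p) = X p (\<lambda>q. \<eta> q (Y q)) - Y p (\<lambda>q. \<eta> q (X q)) - 2 * g p (X p) (\<phi> p (Y p))"
proof -
  have "g p (X p) (\<phi> p (Y p)) = ext_deriv M A \<eta> X Y p"
    using paracontact[unfolded paracontact_metric_structure_def, THEN conjunct2, THEN conjunct2, rule_format, OF assms] .
  then show ?thesis by (simp add: ext_deriv_def)
qed

text \<open>The projections of the tangent space onto the eigenspaces of \<open>\<phi>\<close> in \<open>ker \<eta>\<close> are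
  half of \<open>pr_plus\<close> and \<open>pr_minus\<close>.\<close>

definition pr_plus :: "'a \<Rightarrow> 'a tvec \<Rightarrow> 'a tvec" where "pr_plus p x = x - \<eta> p x *\<^sub>R \<xi> p + \<phi> p x"
definition pr_minus :: "'a \<Rightarrow> 'a tvec \<Rightarrow> 'a tvec" where "pr_minus p x = x - \<eta> p x *\<^sub>R \<xi> p - \<phi> p x"

lemma plus_minus:
  assumes p: "p \<in> topspace M" and x: "x \<in> tangent p"
  shows plus_tangent: "pr_plus p x \<in> tangent p" and minus_tangent: "pr_minus p x \<in> tangent p"
    and phi_plus: "\<phi> p (pr_plus p x) = pr_plus p x" and phi_minus_part: "\<phi> p (pr_minus p x) = - pr_minus p x"
    and eigen_split: "x = \<eta> p x *\<^sub>R \<xi> p + (1/2) *\<^sub>R pr_plus p x + (1/2) *\<^sub>R pr_minus p x"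
proof -
  note t = tangent_subspace[of p] phi_tangent[OF p x] xi_tangent[OF p]
  note sub = subspace_add[OF t(1)] subspace_diff[OF t(1)] subspace_scale[OF t(1)]
  show "pr_plus p x \<in> tangent p" "pr_minus p x \<in> tangent p"
    unfolding pr_plus_def pr_minus_def using x t sub by auto
  show "\<phi> p (pr_plus p x) = pr_plus p x" "\<phi> p (pr_minus p x) = - pr_minus p x"
    unfolding pr_plus_def pr_minus_def using p x t sub
    by (simp_all add: phi_add phi_diff phi_scale phi_xi phi_phi)
  have "(1/2) *\<^sub>R pr_plus p x + (1/2) *\<^sub>R pr_minus p x = (1/2 + 1/2) *\<^sub>R (x - \<eta> p x *\<^sub>R \<xi> p)"
    unfolding pr_plus_def pr_minus_def scaleR_add_left by (simp add: scaleR_add_right scaleR_diff_right)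
  then show "x = \<eta> p x *\<^sub>R \<xi> p + (1/2) *\<^sub>R pr_plus p x + (1/2) *\<^sub>R pr_minus p x"
    by (simp add: add.assoc)
qed

lemma plus_span:
  assumes "p \<in> topspace M" "x \<in> tangent p" "y \<in> tangent p" "\<phi> p x = x" "\<phi> p y = y" "x \<noteq> 0"
  obtains c where "y = c *\<^sub>R x"
proof -
  have "y \<in> span {x}"
    using dim_1_span[OF dim_plus[OF assms(1)], of x] assms eta_eigenvector by blast
  then show ?thesis using that by (auto simp: span_singleton)
qed

lemma minus_span:
  assumes "p \<in> topspace M" "x \<in> tangent p" "y \<in> tangent p" "\<phi> p x = - x" "\<phi> p y = - y" "x \<noteq> 0"
  obtains c where "y = c *\<^sub>R x"
proof -
  have "y \<in> span {x}"
    using dim_1_span[OF dim_minus[OF assms(1)], of x] assms eta_eigenvector by blast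
  then show ?thesis using that by (auto simp: span_singleton)
qed

lemma eigenvectors_exist:
  assumes p: "p \<in> topspace M"
  obtains a b where "a \<in> tangent p" "\<phi> p a = a" "a \<noteq> 0" "b \<in> tangent p" "\<phi> p b = - b" "b \<noteq> 0"
proof -
  obtain a where "a \<in> {x \<in> tangent p. \<eta> p x = 0 \<and> \<phi> p x = x}" "a \<noteq> 0"
    by (rule dim_1_nonzero[OF dim_plus[OF p]])
  moreover obtain b where "b \<in> {x \<in> tangent p. \<eta> p x = 0 \<and> \<phi> p x = - x}" "b \<noteq> 0"
    by (rule dim_1_nonzero[OF dim_minus[OF p]])
  ultimately show ?thesis using that by blast
qed

text \<open>The eigenspaces of \<open>\<phi>\<close> in \<open>ker \<eta>\<close> are lines and
  \<open>\<xi>\<close> spans the rest. This is the bound on the space of derivations that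
  \<open>coordinate_field_span\<close> asks for.\<close>

lemma tangent_span:
  assumes p: "p \<in> topspace M"
  obtains B where "tangent p \<subseteq> span B" "finite B" "card B \<le> 3"
proof -
  obtain a b where a: "a \<in> tangent p" "\<phi> p a = a" "a \<noteq> 0" and b: "b \<in> tangent p" "\<phi> p b = - b" "b \<noteq> 0"
    by (rule eigenvectors_exist[OF p])
  have "x \<in> span {\<xi> p, a, b}" if x: "x \<in> tangent p" for x
  proof -
    obtain c where "pr_plus p x = c *\<^sub>R a"
      using plus_span[OF p a(1) plus_tangent[OF p x] a(2) phi_plus[OF p x] a(3)] .
    moreover obtain d where "pr_minus p x = d *\<^sub>R b"
      using minus_span[OF p b(1) minus_tangent[OF p x] b(2) phi_minus_part[OF p x] b(3)] .
    ultimately have "x = \<eta> p x *\<^sub>R \<xi> p + (1/2) *\<^sub>R c *\<^sub>R a + (1/2) *\<^sub>R d *\<^sub>R b"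
      using eigen_split[OF p x] by simp
    moreover have "\<eta> p x *\<^sub>R \<xi> p + (1/2) *\<^sub>R c *\<^sub>R a + (1/2) *\<^sub>R d *\<^sub>R b \<in> span {\<xi> p, a, b}"
      by (intro span_add span_scale span_base) auto
    ultimately show ?thesis by simp
  qed
  then have "tangent p \<subseteq> span {\<xi> p, a, b}" by blast
  then show ?thesis by (rule that) (simp_all add: card_insert_if)
qed

lemma plus_minus_vf:
  assumes "vf W X"
  shows plus_vf: "vf W (\<lambda>q. pr_plus q (X q))" and minus_vf: "vf W (\<lambda>q. pr_minus q (X q))"
  unfolding pr_plus_def pr_minus_def
  using vf_add[OF vf_diff[OF assms vf_scale[OF eta_smooth[OF assms] xi_vf[OF vf_openin[OF assms]]]] phi_vf[OF assms]]
    vf_diff[OF vf_diff[OF assms vf_scale[OF eta_smooth[OF assms] xi_vf[OF vf_openin[OF assms]]]] phi_vf[OF assms]]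
  by auto

text \<open>The coordinate vectors span the tangent space, so a linear map that is nonzero on some
  tangent vector is nonzero on one of them, and that one comes with a field. It is applied to the
  two eigenprojections.\<close>

lemma field_nonzero:
  assumes c: "(U, \<psi>) \<in> A" and p: "p \<in> U" and L: "linear_map_on (tangent p) L"
    and x: "x \<in> tangent p" "L x \<noteq> (0 :: 'a tvec)"
  obtains X where "vf U X" "L (X p) \<noteq> 0"
proof -
  let ?S = "(\<lambda>v. coordinate_field (U, \<psi>) v p) ` Basis"
  have pM: "p \<in> topspace M" using c p chart(2) by blast
  obtain B where "tangent p \<subseteq> span B" "finite B" "card B \<le> 3" by (rule tangent_span[OF pM])
  then have "x \<in> span ?S" using coordinate_field_span[OF c p] x(1) tensor_fields(3) by auto
  have L0: "L 0 = 0"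
  proof -
    have "L (0 *\<^sub>R 0) = 0 *\<^sub>R L 0"
      using L subspace_0[OF tangent_subspace] unfolding linear_map_on_def by blast
    then show ?thesis by simp
  qed
  have "subspace {y \<in> tangent p. L y = 0}"
    using L L0 tangent_subspace[of p] unfolding linear_map_on_def subspace_def by simp
  then have "\<not> ?S \<subseteq> {y \<in> tangent p. L y = 0}"
    using span_minimal[of ?S "{y \<in> tangent p. L y = 0}"] \<open>x \<in> span ?S\<close> x by blast
  then obtain v where "L (coordinate_field (U, \<psi>) v p) \<noteq> 0"
    using vf_tangent[OF coordinate_field_vf[OF c] p] by blast
  then show ?thesis using that coordinate_field_vf[OF c] by blast
qed

end

locale adapted_frame = paracontact M A g nabla \<phi> \<xi> \<eta>
  for M :: "'a topology" and A :: "('a, 'e::euclidean_space) chart set" and g nabla \<phi> \<xi> \<eta> +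
  fixes W and e f :: "'a vfield"
  assumes e_vf: "vf W e" and f_vf: "vf W f"
    and phi_e: "q \<in> W \<Longrightarrow> \<phi> q (e q) = e q" and phi_f: "q \<in> W \<Longrightarrow> \<phi> q (f q) = - f q"
    and g_ef: "q \<in> W \<Longrightarrow> g q (e q) (f q) = 1"

text \<open>Suitable coordinate fields project to sections of the two eigenlines that do not vanish
  at \<open>p\<close>; rescaling the first one normalises their pairing.\<close>

lemma (in paracontact) adapted_frame_exists:
  assumes p: "p \<in> topspace M"
  obtains W e f where "p \<in> W" "adapted_frame M A g nabla \<phi> \<xi> \<eta> W e f"
proof -
  obtain U \<psi> where c: "(U, \<psi>) \<in> A" "p \<in> U" by (rule chart_at[OF p])
  note sub = tangent_subspace[of p] xi_tangent[OF p] phi_tangent[OF p] subspace_scale[OF tangent_subspace]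
    subspace_add[OF tangent_subspace] subspace_diff[OF tangent_subspace]
  have L: "linear_map_on (tangent p) (pr_plus p)" "linear_map_on (tangent p) (pr_minus p)"
    unfolding linear_map_on_def pr_plus_def pr_minus_def
    using p sub by (auto simp: phi_add phi_scale eta_add eta_scale algebra_simps)
  obtain a b where a: "a \<in> tangent p" "\<phi> p a = a" "a \<noteq> 0" and b: "b \<in> tangent p" "\<phi> p b = - b" "b \<noteq> 0"
    by (rule eigenvectors_exist[OF p])
  have eta: "\<eta> p a = 0" "\<eta> p b = 0" using eta_eigenvector[OF p] a b by auto
  have two: "x + x \<noteq> 0" if "x \<noteq> 0" for x :: "'a tvec"
    using that scaleR_left_distrib[of 1 1 x] by auto
  have "pr_plus p a \<noteq> 0" using a(2) eta(1) two[OF a(3)] by (simp add: pr_plus_def)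
  then obtain X where X: "vf U X" "pr_plus p (X p) \<noteq> 0"
    by (rule field_nonzero[OF c L(1) a(1)])
  have "pr_minus p b \<noteq> 0" using b(2) eta(2) two[OF b(3)] by (simp add: pr_minus_def)
  then obtain Y where Y: "vf U Y" "pr_minus p (Y p) \<noteq> 0"
    by (rule field_nonzero[OF c L(2) b(1)])
  define e1 where "e1 = (\<lambda>q. pr_plus q (X q))"
  define f where "f = (\<lambda>q. pr_minus q (Y q))"
  have e1: "vf U e1" "e1 p \<noteq> 0" and f: "vf U f" "f p \<noteq> 0"
    using plus_vf[OF X(1)] minus_vf[OF Y(1)] X(2) Y(2) by (auto simp: e1_def f_def)
  have phi: "\<phi> q (e1 q) = e1 q" "\<phi> q (f q) = - f q" if q: "q \<in> U" for q
    using that phi_plus[OF vf_topspace[OF X(1) q] vf_tangent[OF X(1) q]]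
      phi_minus_part[OF vf_topspace[OF Y(1) q] vf_tangent[OF Y(1) q]] by (auto simp: e1_def f_def)
  note t = vf_tangent[OF e1(1) c(2)] vf_tangent[OF f(1) c(2)]
  \<comment> \<open>\<open>e1 p\<close> is orthogonal to \<open>\<xi> p\<close> and to its own
    eigenline. Were it orthogonal to \<open>f p\<close> too, nondegeneracy would make it
    zero.\<close>
  have nz: "g p (e1 p) (f p) \<noteq> 0"
  proof
    assume 0: "g p (e1 p) (f p) = 0"
    have "g p (e1 p) z = 0" if z: "z \<in> tangent p" for z
    proof -
      obtain d where d: "pr_minus p z = d *\<^sub>R f p"
        using minus_span[OF p t(2) minus_tangent[OF p z] phi(2)[OF c(2)] phi_minus_part[OF p z] f(2)] .
      have "g p (e1 p) (pr_plus p z) = 0"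
        using g_eigenvectors(1)[OF p t(1) plus_tangent[OF p z] phi(1)[OF c(2)] phi_plus[OF p z]] .
      moreover have "g p (e1 p) (\<xi> p) = 0"
        using g_xi(1)[OF p t(1)] eta_eigenvector[OF p t(1)] phi(1)[OF c(2)] by simp
      ultimately have "g p (e1 p) (\<eta> p z *\<^sub>R \<xi> p + (1/2) *\<^sub>R pr_plus p z + (1/2) *\<^sub>R pr_minus p z) = 0"
        using p t z 0 sub plus_tangent[OF p z] d by (simp add: g_add_right g_scale_right)
      then show ?thesis using eigen_split[OF p z] by simp
    qed
    moreover have "g p 0 z = 0" if "z \<in> tangent p" for z
      using g_scale_left[OF p that that, of 0] by simp
    ultimately have "e1 p = 0"
      using subspace_0[OF tangent_subspace] by (intro g_eqI[OF p t(1)]) auto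
    then show False using e1(2) by simp
  qed
  define \<gamma> where "\<gamma> = (\<lambda>q. g q (e1 q) (f q))"
  have \<gamma>: "smooth U \<gamma>" unfolding \<gamma>_def using e1(1) f(1) by (rule g_smooth)
  \<comment> \<open>The repeated \<open>U\<close> is the shape of
    \<open>openin_smooth_nonzero\<close>: \<open>U\<close> is both the chart domain and the domain
    of \<open>\<gamma>\<close>.\<close>
  define W where "W = {q \<in> U \<inter> U. \<gamma> q \<noteq> 0}"
  have W: "openin M W" "W \<subseteq> U" unfolding W_def using openin_smooth_nonzero[OF \<gamma> c(1)] by auto
  have i: "smooth W (\<lambda>q. inverse (\<gamma> q))"
    by (rule smooth_inverse[OF smooth_subset[OF \<gamma> W]]) (simp add: W_def)
  define e where "e = (\<lambda>q. inverse (\<gamma> q) *\<^sub>R e1 q)"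
  have ev: "vf W e" unfolding e_def by (rule vf_scale[OF i vf_subset[OF e1(1) W]])
  have fv: "vf W f" by (rule vf_subset[OF f(1) W])
  show ?thesis
  proof (rule that)
    show "p \<in> W" using c nz by (simp add: W_def \<gamma>_def)
    show "adapted_frame M A g nabla \<phi> \<xi> \<eta> W e f"
    proof
      show "vf W e" "vf W f" by fact+
      fix q assume q: "q \<in> W"
      then have qU: "q \<in> U" and g0: "\<gamma> q \<noteq> 0" by (auto simp: W_def)
      note t = vf_topspace[OF f(1) qU] vf_tangent[OF e1(1) qU] vf_tangent[OF f(1) qU]
      show "\<phi> q (e q) = e q" unfolding e_def using phi_scale[OF t(1,2)] phi(1)[OF qU] by simp
      show "\<phi> q (f q) = - f q" using phi(2)[OF qU] .
      show "g q (e q) (f q) = 1"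
        unfolding e_def using g_scale_left[OF t(1,3,2)] g0 by (simp add: \<gamma>_def)
    qed
  qed
qed

section \<open>Curvature in an adapted frame\<close>

context adapted_frame
begin

lemma W_open: "openin M W" and W_topspace: "q \<in> W \<Longrightarrow> q \<in> topspace M"
  using e_vf vf_openin vf_topspace by auto

lemma xi_vf_W: "vf W \<xi>" by (rule xi_vf[OF W_open])

lemma frame_tangent [simp]:
  assumes "q \<in> W"
  shows "e q \<in> tangent q" "f q \<in> tangent q" "\<xi> q \<in> tangent q"
  using assms vf_tangent e_vf f_vf xi_vf_W by blast+

lemma eta_frame [simp]:
  assumes "q \<in> W"
  shows "\<eta> q (e q) = 0" "\<eta> q (f q) = 0" "\<eta> q (\<xi> q) = 1"
  using eta_eigenvector[OF W_topspace[OF assms]] phi_e[OF assms] phi_f[OF assms] assms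
    eta_xi[OF W_topspace[OF assms]] by simp_all

lemma g_frame [simp]:
  assumes "q \<in> W"
  shows "g q (e q) (e q) = 0" "g q (f q) (f q) = 0" "g q (e q) (f q) = 1" "g q (f q) (e q) = 1"
    "g q (\<xi> q) (\<xi> q) = 1" "g q (e q) (\<xi> q) = 0" "g q (\<xi> q) (e q) = 0"
    "g q (f q) (\<xi> q) = 0" "g q (\<xi> q) (f q) = 0"
proof -
  note p = W_topspace[OF assms]
  show "g q (e q) (e q) = 0" "g q (f q) (f q) = 0"
    using g_eigenvectors[OF p] phi_e phi_f assms by simp_all
  show "g q (e q) (f q) = 1" "g q (f q) (e q) = 1"
    using g_ef assms g_commute[OF p frame_tangent(1,2)[OF assms]] by simp_all
  show "g q (\<xi> q) (\<xi> q) = 1" "g q (e q) (\<xi> q) = 0" "g q (\<xi> q) (e q) = 0"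
    "g q (f q) (\<xi> q) = 0" "g q (\<xi> q) (f q) = 0"
    using g_xi[OF p] assms by simp_all
qed

text \<open>Since \<open>e\<close> and \<open>f\<close> are null with pairing 1, the coefficient of
  each is the product with the other.\<close>

lemma expand:
  assumes q: "q \<in> W" and x: "x \<in> tangent q"
  shows "x = \<eta> q x *\<^sub>R \<xi> q + g q x (f q) *\<^sub>R e q + g q x (e q) *\<^sub>R f q"
proof -
  note p = W_topspace[OF q]
  note sub = subspace_add[OF tangent_subspace] subspace_scale[OF tangent_subspace]
  have ne: "e q \<noteq> 0" "f q \<noteq> 0"
  proof -
    have "g q (0 *\<^sub>R e q) (f q) = 0" using g_scale_left[OF p, of "f q" "e q" 0] q by simp
    then show "e q \<noteq> 0" using g_ef[OF q] by auto
    have "g q (0 *\<^sub>R f q) (e q) = 0" using g_scale_left[OF p, of "e q" "f q" 0] q by simp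
    then show "f q \<noteq> 0" using g_frame(4)[OF q] by auto
  qed
  obtain c where c: "pr_plus q x = c *\<^sub>R e q"
    by (rule plus_span[OF p frame_tangent(1)[OF q] plus_tangent[OF p x] phi_e[OF q] phi_plus[OF p x] ne(1)])
  obtain d where d: "pr_minus q x = d *\<^sub>R f q"
    by (rule minus_span[OF p frame_tangent(2)[OF q] minus_tangent[OF p x] phi_f[OF q] phi_minus_part[OF p x] ne(2)])
  have eq: "x = \<eta> q x *\<^sub>R \<xi> q + (c/2) *\<^sub>R e q + (d/2) *\<^sub>R f q"
    using eigen_split[OF p x] c d by simp
  have g: "g q (\<eta> q x *\<^sub>R \<xi> q + (c/2) *\<^sub>R e q + (d/2) *\<^sub>R f q) (f q) = c/2"
    "g q (\<eta> q x *\<^sub>R \<xi> q + (c/2) *\<^sub>R e q + (d/2) *\<^sub>R f q) (e q) = d/2"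
    using p q sub by (simp_all add: g_add_left g_scale_left)
  show ?thesis using eq unfolding g[folded eq] .
qed

section \<open>Tensoriality of the curvature and its values at a point\<close>

lemma field_expand:
  assumes "vf V X" "V \<subseteq> W"
  defines "X1 \<equiv> \<lambda>q. \<eta> q (X q) *\<^sub>R \<xi> q"
    and "X2 \<equiv> \<lambda>q. g q (X q) (f q) *\<^sub>R e q"
    and "X3 \<equiv> \<lambda>q. g q (X q) (e q) *\<^sub>R f q"
  shows "\<And>q. q \<in> V \<Longrightarrow> X q = X1 q + X2 q + X3 q"
    "vf V X1" "vf V X2" "vf V X3" "vf V \<xi>" "vf V e" "vf V f"
    "smooth V (\<lambda>q. \<eta> q (X q))" "smooth V (\<lambda>q. g q (X q) (f q))" "smooth V (\<lambda>q. g q (X q) (e q))"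
proof -
  note o = vf_openin[OF assms(1)]
  show v: "vf V \<xi>" "vf V e" "vf V f" using vf_subset[OF _ o assms(2)] xi_vf_W e_vf f_vf by auto
  show s: "smooth V (\<lambda>q. \<eta> q (X q))" "smooth V (\<lambda>q. g q (X q) (f q))" "smooth V (\<lambda>q. g q (X q) (e q))"
    using eta_smooth[OF assms(1)] g_smooth[OF assms(1)] v by auto
  show "vf V X1" "vf V X2" "vf V X3" unfolding X1_def X2_def X3_def using vf_scale s v by auto
  show "X q = X1 q + X2 q + X3 q" if "q \<in> V" for q
    unfolding X1_def X2_def X3_def using expand vf_tangent[OF assms(1)] that assms(2) by blast
qed

lemma nabla_expand:
  assumes X: "vf V X" and Y: "vf V Y" and V: "V \<subseteq> W" and q: "q \<in> V"
  shows "nabla X Y q = \<eta> q (X q) *\<^sub>R nabla \<xi> Y q + g q (X q) (f q) *\<^sub>R nabla e Y q + g q (X q) (e q) *\<^sub>R nabla f Y q"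
proof -
  note E = field_expand[OF X V]
  show ?thesis
    using nabla_cong[OF X Y E(1) refl q] nabla_add_left[OF vf_add[OF E(2,3)] E(4) Y q]
      nabla_add_left[OF E(2,3) Y q] nabla_scale_left[OF E(5) Y E(8) q]
      nabla_scale_left[OF E(6) Y E(9) q] nabla_scale_left[OF E(7) Y E(10) q] by simp
qed

lemma curvature_expand:
  assumes X: "vf V X" and Y: "vf V Y" and Z: "vf V Z" and V: "V \<subseteq> W" and q: "q \<in> V"
  shows "R X Y Z q = \<eta> q (X q) *\<^sub>R R \<xi> Y Z q + g q (X q) (f q) *\<^sub>R R e Y Z q + g q (X q) (e q) *\<^sub>R R f Y Z q"
proof -
  note E = field_expand[OF X V]
  show ?thesis
    using curvature_cong[OF X Y Z q E(1)] curvature_add[OF vf_add[OF E(2,3)] E(4) Y Z q]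
      curvature_add[OF E(2,3) Y Z q] curvature_scale[OF E(5) Y Z E(8) q]
      curvature_scale[OF E(6) Y Z E(9) q] curvature_scale[OF E(7) Y Z E(10) q] by simp
qed

text \<open>Extension with constant frame coefficients: it makes each tangent vector at
  \<open>q\<close> the value of a field on all of \<open>W\<close>, linearly in
  \<open>x\<close>.\<close>

definition extend :: "'a \<Rightarrow> 'a tvec \<Rightarrow> 'a vfield"
  where "extend q x = (\<lambda>r. \<eta> q x *\<^sub>R \<xi> r + g q x (f q) *\<^sub>R e r + g q x (e q) *\<^sub>R f r)"

lemma extend_vf: "vf W (extend q x)"
  unfolding extend_def by (intro vf_add vf_cscale xi_vf_W e_vf f_vf)

lemma extend_at: "q \<in> W \<Longrightarrow> x \<in> tangent q \<Longrightarrow> extend q x q = x"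
  unfolding extend_def using expand by metis

text \<open>The first slot is expanded in the frame, the second follows by exchanging it with the
  first, and the third by exchanging it with a test field \<open>U\<close> under the metric.\<close>

lemma curvature_tensorial:
  assumes V: "V \<subseteq> W" "q \<in> V"
    and X: "vf V X" "vf V X'" "X q = X' q" and Y: "vf V Y" "vf V Y'" "Y q = Y' q"
    and Z: "vf V Z" "vf V Z'" "Z q = Z' q"
  shows "R X Y Z q = R X' Y' Z' q"
proof -
  have 1: "R B C D q = R B' C D q" if "vf V B" "vf V B'" "B q = B' q" "vf V C" "vf V D" for B B' C D
    using curvature_expand[OF that(1,4,5) V] curvature_expand[OF that(2,4,5) V] that(3) by simp
  have 2: "R B C D q = R B C' D q" if "vf V C" "vf V C'" "C q = C' q" "vf V B" "vf V D" for B C C' D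
    using 1[OF that] curvature_skew[OF that(4,1,5) V(2)] curvature_skew[OF that(4,2,5) V(2)] by simp
  have q: "q \<in> W" using V by blast
  note p = W_topspace[OF q]
  have "R X' Y' Z q = R X' Y' Z' q"
  proof (rule g_eqI[OF p])
    show "R X' Y' Z q \<in> tangent q" "R X' Y' Z' q \<in> tangent q"
      using vf_tangent[OF curvature_vf V(2)] X Y Z by auto
    fix z assume z: "z \<in> tangent q"
    define U where "U = extend q z"
    have U: "vf V U" "U q = z"
      unfolding U_def using vf_subset[OF extend_vf vf_openin[OF X(1)] V(1)] extend_at[OF q z] by auto
    show "g q (R X' Y' Z q) z = g q (R X' Y' Z' q) z"
      using curvature_skew_metric[OF X(2) Y(2) Z(1) U(1) V(2)] curvature_skew_metric[OF X(2) Y(2) Z(2) U(1) V(2)]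
        Z(3) U(2) by simp
  qed
  then show ?thesis using 1[OF X Y(1) Z(1)] 2[OF Y X(2) Z(1)] by simp
qed

text \<open>Tensoriality makes the \<open>THE\<close> in \<open>curvature_at\<close> well defined.
  Competing extensions live on an arbitrary open set, so the comparison takes place on its
  intersection with \<open>W\<close>.\<close>

lemma curvature_at_eq:
  assumes q: "q \<in> W" and X: "vf W X" and Y: "vf W Y" and Z: "vf W Z"
  shows "curvature_at M A nabla q (X q) (Y q) (Z q) = R X Y Z q"
  unfolding curvature_at_def
proof (rule the_equality)
  show "\<exists>U X' Y' Z'. q \<in> U \<and> vf U X' \<and> vf U Y' \<and> vf U Z' \<and> X' q = X q \<and> Y' q = Y q \<and> Z' q = Z q
      \<and> R X Y Z q = R X' Y' Z' q"
    using assms by blast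
  fix w assume "\<exists>U X' Y' Z'. q \<in> U \<and> vf U X' \<and> vf U Y' \<and> vf U Z' \<and> X' q = X q \<and> Y' q = Y q \<and> Z' q = Z q
      \<and> w = R X' Y' Z' q"
  then obtain U X' Y' Z' where U: "q \<in> U" "vf U X'" "vf U Y'" "vf U Z'" "X' q = X q" "Y' q = Y q" "Z' q = Z q"
    and w: "w = R X' Y' Z' q" by blast
  have V: "openin M (U \<inter> W)" "U \<inter> W \<subseteq> U" "U \<inter> W \<subseteq> W" "q \<in> U \<inter> W"
    using openin_Int[OF vf_openin[OF U(2)] W_open] q U(1) by auto
  show "w = R X Y Z q"
    unfolding w
    by (rule curvature_tensorial[OF V(3,4) vf_subset[OF U(2) V(1,2)] vf_subset[OF X V(1,3)] U(5)
          vf_subset[OF U(3) V(1,2)] vf_subset[OF Y V(1,3)] U(6)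
          vf_subset[OF U(4) V(1,2)] vf_subset[OF Z V(1,3)] U(7)])
qed

definition Rm :: "'a \<Rightarrow> 'a tvec \<Rightarrow> 'a tvec \<Rightarrow> 'a tvec \<Rightarrow> 'a tvec \<Rightarrow> real"
  where "Rm q x y z v = g q (curvature_at M A nabla q x y z) v"

lemma curvature_at_extend:
  assumes "q \<in> W" "x \<in> tangent q" "y \<in> tangent q" "z \<in> tangent q"
  shows "curvature_at M A nabla q x y z = R (extend q x) (extend q y) (extend q z) q"
  using curvature_at_eq[OF assms(1) extend_vf[of q x] extend_vf[of q y] extend_vf[of q z]]
    extend_at[OF assms(1)] assms by simp

lemma curvature_at_tangent:
  assumes "q \<in> W" "x \<in> tangent q" "y \<in> tangent q" "z \<in> tangent q"
  shows "curvature_at M A nabla q x y z \<in> tangent q"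
  unfolding curvature_at_extend[OF assms]
  using vf_tangent[OF curvature_vf[OF extend_vf extend_vf extend_vf] assms(1)] .

lemma curvature_at_linear:
  assumes q: "q \<in> W" and y: "y \<in> tangent q" and z: "z \<in> tangent q"
  shows "linear_map_on (tangent q) (\<lambda>x. curvature_at M A nabla q x y z)"
  unfolding linear_map_on_def
proof (intro conjI ballI allI)
  note p = W_topspace[OF q]
  fix x assume x: "x \<in> tangent q"
  {
    fix x' assume x': "x' \<in> tangent q"
    have "extend q (x + x') = (\<lambda>r. extend q x r + extend q x' r)"
      unfolding extend_def using p q x x' by (simp add: eta_add g_add_left algebra_simps)
    then show "curvature_at M A nabla q (x + x') y z = curvature_at M A nabla q x y z + curvature_at M A nabla q x' y z"
      using curvature_at_extend[OF q subspace_add[OF tangent_subspace x x'] y z]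
        curvature_at_extend[OF q x y z] curvature_at_extend[OF q x' y z]
        curvature_add[OF extend_vf extend_vf extend_vf extend_vf q] by simp
  }
  fix c
  have "extend q (c *\<^sub>R x) = (\<lambda>r. c *\<^sub>R extend q x r)"
    unfolding extend_def using p q x by (simp add: eta_scale g_scale_left algebra_simps)
  then show "curvature_at M A nabla q (c *\<^sub>R x) y z = c *\<^sub>R curvature_at M A nabla q x y z"
    using curvature_at_extend[OF q subspace_scale[OF tangent_subspace x] y z]
      curvature_at_extend[OF q x y z]
      curvature_scale[OF extend_vf extend_vf extend_vf smooth_const[OF W_open, of c] q] by simp
qed

lemma Rm_skew:
  assumes q: "q \<in> W" and x: "x \<in> tangent q" and y: "y \<in> tangent q" and z: "z \<in> tangent q" and v: "v \<in> tangent q"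
  shows "Rm q x y z v = - Rm q y x z v" "Rm q x y z v = - Rm q x y v z"
proof -
  note p = W_topspace[OF q]
  have "curvature_at M A nabla q x y z = - curvature_at M A nabla q y x z"
    unfolding curvature_at_extend[OF q x y z] curvature_at_extend[OF q y x z]
    by (rule curvature_skew[OF extend_vf extend_vf extend_vf q])
  then show "Rm q x y z v = - Rm q y x z v"
    unfolding Rm_def using g_minus_left[OF p v curvature_at_tangent[OF q y x z]] by simp
  show "Rm q x y z v = - Rm q x y v z"
    unfolding Rm_def curvature_at_extend[OF q x y z] curvature_at_extend[OF q x y v]
    using curvature_skew_metric[OF extend_vf[of q x] extend_vf[of q y] extend_vf[of q z] extend_vf[of q v] q]
      extend_at[OF q z] extend_at[OF q v] by simp
qed

lemma ricci_eq:
  assumes q: "q \<in> W" and y: "y \<in> tangent q" and z: "z \<in> tangent q"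
  shows "ricci M A nabla q y z = Rm q (\<xi> q) y z (\<xi> q) + Rm q (e q) y z (f q) + Rm q (f q) y z (e q)"
proof -
  note p = W_topspace[OF q]
  define E where "E = (\<lambda>i::nat. if i = 0 then \<xi> q else if i = 1 then e q else f q)"
  \<comment> \<open>The family dual to \<open>E\<close> under \<open>g\<close>: the null vectors
    \<open>e\<close> and \<open>f\<close> trade places.\<close>
  define E' where "E' = (\<lambda>i::nat. if i = 0 then \<xi> q else if i = 1 then f q else e q)"
  have "trace_on (tangent q) (\<lambda>x. curvature_at M A nabla q x y z)
      = (\<Sum>i\<in>{0,1,2}. g q (curvature_at M A nabla q (E i) y z) (E' i))"
  proof (rule trace_on_eq[where \<theta> = "\<lambda>i x. g q x (E' i)"])
    show "E i \<in> tangent q" for i using q by (simp add: E_def)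
    have E': "E' i \<in> tangent q" for i using q by (simp add: E'_def)
    show "x = (\<Sum>i\<in>{0,1,2}. g q x (E' i) *\<^sub>R E i)" if x: "x \<in> tangent q" for x
      using expand[OF q x] g_xi[OF p x] by (simp add: E_def E'_def add.assoc)
    show "linear_map_on (tangent q) (\<lambda>x. g q x (E' i))" for i
      unfolding linear_map_on_def using p E'[of i] by (simp add: g_add_left g_scale_left)
  qed (use curvature_at_linear[OF assms] curvature_at_tangent[OF q _ y z] tangent_subspace in auto)
  then show ?thesis unfolding ricci_def Rm_def E_def E'_def by simp
qed

text \<open>Linearity is at hand in the first slot of the curvature and in the metric slot; skew
  symmetry carries it to the second and third slots.\<close>

lemma Rm_linear:
  assumes q: "q \<in> W" and x: "x \<in> tangent q" and y: "y \<in> tangent q" and z: "z \<in> tangent q"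
    and v: "v \<in> tangent q"
  shows Rm_add: "z' \<in> tangent q \<Longrightarrow> Rm q x y (z + z') v = Rm q x y z v + Rm q x y z' v"
    and Rm_scale: "Rm q x y (c *\<^sub>R z) v = c * Rm q x y z v"
    and Rm_scale2: "Rm q x (c *\<^sub>R y) z v = c * Rm q x y z v"
proof -
  note p = W_topspace[OF q] and sub = subspace_add[OF tangent_subspace] subspace_scale[OF tangent_subspace]
  note c = curvature_at_tangent[OF q x y v]
  have flip: "Rm q x y u v = - g q (curvature_at M A nabla q x y v) u" if "u \<in> tangent q" for u
    using Rm_skew(2)[OF q x y that v] unfolding Rm_def .
  show "z' \<in> tangent q \<Longrightarrow> Rm q x y (z + z') v = Rm q x y z v + Rm q x y z' v"
    and "Rm q x y (c *\<^sub>R z) v = c * Rm q x y z v"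
    using z sub g_add_right[OF p c z] g_scale_right[OF p c z] by (simp_all add: flip)
  have "curvature_at M A nabla q (c *\<^sub>R y) x z = c *\<^sub>R curvature_at M A nabla q y x z"
    using curvature_at_linear[OF q x z] y unfolding linear_map_on_def by blast
  then have "Rm q (c *\<^sub>R y) x z v = c * Rm q y x z v"
    unfolding Rm_def using g_scale_left[OF p v curvature_at_tangent[OF q y x z]] by simp
  then show "Rm q x (c *\<^sub>R y) z v = c * Rm q x y z v"
    using Rm_skew(1)[OF q x sub(2)[OF y] z v, of c] Rm_skew(1)[OF q x y z v] by simp
qed

text \<open>Existence for the \<open>THE\<close> comes from raising the index with the dual frame
  \<open>\<xi>, f, e\<close>, uniqueness from nondegeneracy.\<close>

lemma ricci_operator:
  assumes q: "q \<in> W" and x: "x \<in> tangent q"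
  shows "ricci_operator M A g nabla q x \<in> tangent q"
    "\<And>y. y \<in> tangent q \<Longrightarrow> g q (ricci_operator M A g nabla q x) y = ricci M A nabla q x y"
proof -
  note p = W_topspace[OF q] and sub = subspace_add[OF tangent_subspace] subspace_scale[OF tangent_subspace]
  let ?r = "ricci M A nabla q x"
  define w where "w = ?r (\<xi> q) *\<^sub>R \<xi> q + ?r (f q) *\<^sub>R e q + ?r (e q) *\<^sub>R f q"
  have w: "w \<in> tangent q" unfolding w_def using q sub by simp
  have add: "?r (y + z) = ?r y + ?r z" if "y \<in> tangent q" "z \<in> tangent q" for y z
    using q x that sub by (simp add: ricci_eq Rm_add)
  have scale: "?r (c *\<^sub>R y) = c * ?r y" if "y \<in> tangent q" for y c
    using q x that sub by (simp add: ricci_eq Rm_scale algebra_simps)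
  have gw: "g q w y = ?r y" if y: "y \<in> tangent q" for y
  proof -
    have "?r y = ?r (\<eta> q y *\<^sub>R \<xi> q + g q y (f q) *\<^sub>R e q + g q y (e q) *\<^sub>R f q)"
      using expand[OF q y] by simp
    also have "\<dots> = \<eta> q y * ?r (\<xi> q) + g q y (f q) * ?r (e q) + g q y (e q) * ?r (f q)"
      using q sub by (simp add: add scale)
    also have "\<dots> = g q w y"
      unfolding w_def using p q y sub g_commute[OF p y frame_tangent(1)[OF q]] g_commute[OF p y frame_tangent(2)[OF q]]
      by (simp add: g_add_left g_scale_left g_xi)
    finally show ?thesis by simp
  qed
  have "ricci_operator M A g nabla q x = w"
    unfolding ricci_operator_def
  proof (rule the_equality)
    fix u assume "u \<in> tangent q \<and> (\<forall>y\<in>tangent q. g q u y = ?r y)"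
    then show "u = w" using g_eqI[OF p _ w, of u] gw by simp
  qed (use w gw in blast)
  then show "ricci_operator M A g nabla q x \<in> tangent q"
    "\<And>y. y \<in> tangent q \<Longrightarrow> g q (ricci_operator M A g nabla q x) y = ricci M A nabla q x y"
    using w gw by auto
qed

end

section \<open>Connection forms\<close>

context adapted_frame
begin

text \<open>With \<open>beta\<close> and \<open>omega\<close> below, the entries of the connection
  matrix of the frame. \<open>alpha e\<close> and \<open>beta f\<close> are the coefficients
  \<open>s\<close> and \<open>t\<close>; the other three that remain free are the values of
  \<open>omega\<close> on the frame.\<close>

definition alpha :: "'a vfield \<Rightarrow> 'a \<Rightarrow> real" where "alpha X = (\<lambda>q. g q (nabla X \<xi> q) (e q))"
definition beta :: "'a vfield \<Rightarrow> 'a \<Rightarrow> real" where "beta X = (\<lambda>q. g q (nabla X \<xi> q) (f q))"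
definition omega :: "'a vfield \<Rightarrow> 'a \<Rightarrow> real" where "omega X = (\<lambda>q. g q (nabla X e q) (f q))"

lemma forms_smooth:
  assumes "vf W X"
  shows "smooth W (alpha X)" "smooth W (beta X)" "smooth W (omega X)"
  unfolding alpha_def beta_def omega_def
  using g_smooth[OF nabla_vf[OF assms xi_vf_W] e_vf] g_smooth[OF nabla_vf[OF assms xi_vf_W] f_vf]
    g_smooth[OF nabla_vf[OF assms e_vf] f_vf] by auto

lemma derivative_of_constant:
  assumes "x \<in> tangent q" "q \<in> W" "\<And>r. r \<in> W \<Longrightarrow> h r = c"
  shows "x h = 0"
  using tangent_cong[OF assms(1) smooth_const[OF W_open, of c] assms(2), of h] assms(3)
    tangent_const[OF assms(1) W_topspace[OF assms(2)], of c] by simp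

text \<open>All pairings of frame fields are constant, so the connection matrix is skew with respect
  to \<open>g\<close> and three forms describe it. Zero terms are kept to preserve the three-term
  shape that \<open>combination_diff\<close> and \<open>g_combination\<close> match.\<close>

lemma nabla_frame:
  assumes X: "vf W X" and q: "q \<in> W"
  shows "nabla X \<xi> q = 0 *\<^sub>R \<xi> q + beta X q *\<^sub>R e q + alpha X q *\<^sub>R f q"
    "nabla X e q = (- alpha X q) *\<^sub>R \<xi> q + omega X q *\<^sub>R e q + 0 *\<^sub>R f q"
    "nabla X f q = (- beta X q) *\<^sub>R \<xi> q + 0 *\<^sub>R e q + (- omega X q) *\<^sub>R f q"
proof -
  note p = W_topspace[OF q]
  have t: "nabla X Y q \<in> tangent q" if "vf W Y" for Y
    using vf_tangent[OF nabla_vf[OF X that] q] .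
  have skew: "g q (nabla X Y q) (Z q) = - g q (nabla X Z q) (Y q)"
    if Y: "vf W Y" and Z: "vf W Z" and c: "\<And>r. r \<in> W \<Longrightarrow> g r (Y r) (Z r) = c" for Y Z c
  proof -
    have "X q (\<lambda>r. g r (Y r) (Z r)) = 0"
      by (rule derivative_of_constant[OF vf_tangent[OF X q] q]) (rule c)
    then show ?thesis
      using metric_compatible[OF X Y Z q] g_commute[OF p vf_tangent[OF Y q] t[OF Z]] by simp
  qed
  note k = xi_vf_W e_vf f_vf
  have z: "\<eta> q (nabla X \<xi> q) = 0" "g q (nabla X e q) (e q) = 0" "g q (nabla X f q) (f q) = 0"
    using skew[OF k(1,1), of 1] skew[OF k(2,2), of 0] skew[OF k(3,3), of 0] g_xi(1)[OF p t[OF k(1)]] by simp_all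
  have o: "\<eta> q (nabla X e q) = - alpha X q" "\<eta> q (nabla X f q) = - beta X q"
    "g q (nabla X f q) (e q) = - omega X q"
    unfolding alpha_def beta_def omega_def
    using skew[OF k(2,1), of 0] skew[OF k(3,1), of 0] skew[OF k(3,2), of 1]
      g_xi(1)[OF p t[OF k(2)]] g_xi(1)[OF p t[OF k(3)]] by simp_all
  have d: "g q (nabla X \<xi> q) (e q) = alpha X q" "g q (nabla X \<xi> q) (f q) = beta X q"
    "g q (nabla X e q) (f q) = omega X q"
    by (simp_all add: alpha_def beta_def omega_def)
  show "nabla X \<xi> q = 0 *\<^sub>R \<xi> q + beta X q *\<^sub>R e q + alpha X q *\<^sub>R f q"
    using expand[OF q t[OF k(1)]] unfolding z o d .
  show "nabla X e q = (- alpha X q) *\<^sub>R \<xi> q + omega X q *\<^sub>R e q + 0 *\<^sub>R f q"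
    using expand[OF q t[OF k(2)]] unfolding z o d .
  show "nabla X f q = (- beta X q) *\<^sub>R \<xi> q + 0 *\<^sub>R e q + (- omega X q) *\<^sub>R f q"
    using expand[OF q t[OF k(3)]] unfolding z o d .
qed

lemmas frame_vfs = xi_vf_W e_vf f_vf

lemma g_combination:
  assumes q: "q \<in> W"
  shows "\<eta> q (a *\<^sub>R \<xi> q + b *\<^sub>R e q + c *\<^sub>R f q) = a"
    "g q (a *\<^sub>R \<xi> q + b *\<^sub>R e q + c *\<^sub>R f q) (f q) = b"
    "g q (a *\<^sub>R \<xi> q + b *\<^sub>R e q + c *\<^sub>R f q) (e q) = c"
  using q W_topspace[OF q] subspace_add[OF tangent_subspace] subspace_scale[OF tangent_subspace]
  by (simp_all add: eta_add eta_scale g_add_left g_scale_left)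

lemma g_combinations:
  assumes q: "q \<in> W"
  shows "g q (a *\<^sub>R \<xi> q + b *\<^sub>R e q + c *\<^sub>R f q) (a' *\<^sub>R \<xi> q + b' *\<^sub>R e q + c' *\<^sub>R f q) = a * a' + b * c' + c * b'"
  using q W_topspace[OF q] subspace_add[OF tangent_subspace] subspace_scale[OF tangent_subspace]
  by (simp add: g_add_left g_scale_left g_add_right g_scale_right algebra_simps)

text \<open>The paracontact condition fixes the \<open>\<eta>\<close>-component of every bracket of
  frame fields. This gives \<open>alpha \<xi> = beta \<xi> = 0\<close> and
  \<open>alpha f - beta e = 2\<close>. The missing relation \<open>alpha f + beta e = 0\<close> is
  the \<open>\<eta>\<close>-component of the Jacobi identity for \<open>\<xi>, e, f\<close>, in
  which \<open>omega \<xi>\<close> cancels; it expresses that \<open>d\<eta>\<close> is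
  closed.\<close>

lemma form_values:
  assumes q: "q \<in> W"
  shows "alpha \<xi> q = 0" "beta \<xi> q = 0" "alpha f q = 1" "beta e q = -1"
proof -
  have const: "x (\<lambda>r. \<eta> r (Y r)) = 0" if "x \<in> tangent r" "r \<in> W" "\<And>r. r \<in> W \<Longrightarrow> \<eta> r (Y r) = c" for x Y r c
    by (rule derivative_of_constant[OF that(1,2)]) (rule that(3))
  have br: "\<eta> r (bracket X Y r) = - 2 * g r (X r) (\<phi> r (Y r))"
    if "vf W X" "vf W Y" "r \<in> W" "\<And>r. r \<in> W \<Longrightarrow> \<eta> r (X r) = a" "\<And>r. r \<in> W \<Longrightarrow> \<eta> r (Y r) = b" for X Y r a b
    using eta_bracket[OF that(1-3)] const[OF vf_tangent[OF that(1,3)] that(3,5)]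
      const[OF vf_tangent[OF that(2,3)] that(3,4)] by simp
  have xe: "bracket \<xi> e r = (- alpha \<xi> r) *\<^sub>R \<xi> r + (omega \<xi> r - beta e r) *\<^sub>R e r + (- alpha e r) *\<^sub>R f r"
    and xf: "bracket \<xi> f r = (- beta \<xi> r) *\<^sub>R \<xi> r + (- beta f r) *\<^sub>R e r + (- omega \<xi> r - alpha f r) *\<^sub>R f r"
    and ef: "bracket e f r = (alpha f r - beta e r) *\<^sub>R \<xi> r + (- omega f r) *\<^sub>R e r + (- omega e r) *\<^sub>R f r"
    if r: "r \<in> W" for r
    unfolding torsion_free[OF frame_vfs(1,2) r] torsion_free[OF frame_vfs(1,3) r] torsion_free[OF frame_vfs(2,3) r]
      nabla_frame[OF frame_vfs(1) r] nabla_frame[OF frame_vfs(2) r] nabla_frame[OF frame_vfs(3) r]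
      combination_diff
    by simp_all
  have exe: "\<eta> r (bracket \<xi> e r) = 0" and exf: "\<eta> r (bracket \<xi> f r) = 0" and eef: "\<eta> r (bracket e f r) = 2"
    if r: "r \<in> W" for r
    using br[OF frame_vfs(1,2) r, of 1 0] br[OF frame_vfs(1,3) r, of 1 0] br[OF frame_vfs(2,3) r, of 0 0]
      phi_e[OF r] phi_f[OF r] r g_minus_right[OF W_topspace[OF r]] by simp_all
  show "alpha \<xi> q = 0" "beta \<xi> q = 0"
    using exe[OF q] exf[OF q] unfolding xe[OF q] xf[OF q] g_combination[OF q] by simp_all
  have two: "alpha f q - beta e q = 2"
    using eef[OF q] unfolding ef[OF q] g_combination[OF q] .
  note bv = bracket_vf[OF frame_vfs(1,2)] bracket_vf[OF frame_vfs(1,3)] bracket_vf[OF frame_vfs(2,3)]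
  note p = W_topspace[OF q] and bt = bv[THEN vf_tangent, OF q]
  \<comment> \<open>\<open>\<eta> [e, f]\<close> is the constant 2, and \<open>\<xi>\<close> is
    orthogonal to the image of \<open>\<phi>\<close>.\<close>
  have "\<eta> q (bracket \<xi> (bracket e f) q) = 0"
    using br[OF frame_vfs(1) bv(3) q, of 1 2] eef eta_phi[OF p bt(3)] phi_tangent[OF p bt(3)] q
    by (simp add: g_xi[OF p])
  moreover have "\<eta> q (bracket (bracket \<xi> e) f q) = 2 * (omega \<xi> q - beta e q)"
    using br[OF bv(1) frame_vfs(3) q, of 0 0] exe phi_f[OF q] g_minus_right[OF p bt(1)] q
      g_combination(2)[OF q, of "- alpha \<xi> q" "omega \<xi> q - beta e q" "- alpha e q", folded xe[OF q]] by simp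
  moreover have "\<eta> q (bracket e (bracket \<xi> f) q) = 2 * (- omega \<xi> q - alpha f q)"
  proof -
    have "g q (e q) (\<phi> q (bracket \<xi> f q)) = - g q (bracket \<xi> f q) (e q)"
      using g_phi_skew[OF p _ bt(2), of "e q"] g_commute[OF p _ bt(2), of "e q"] phi_e[OF q] q by simp
    then show ?thesis
      using br[OF frame_vfs(2) bv(2) q, of 0 0] exf q
        g_combination(3)[OF q, of "- beta \<xi> q" "- beta f q" "- omega \<xi> q - alpha f q", folded xf[OF q]] by simp
  qed
  moreover have "\<eta> q (bracket \<xi> (bracket e f) q) = \<eta> q (bracket (bracket \<xi> e) f q) + \<eta> q (bracket e (bracket \<xi> f) q)"
    unfolding lie_bracket_jacobi[OF frame_vfs q]
    using eta_add[OF p vf_tangent[OF bracket_vf[OF bv(1) frame_vfs(3)] q] vf_tangent[OF bracket_vf[OF frame_vfs(2) bv(2)] q]] .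
  ultimately show "alpha f q = 1" "beta e q = -1" using two by simp_all
qed

lemma frame_brackets:
  assumes r: "r \<in> W"
  shows "bracket \<xi> e r = 0 *\<^sub>R \<xi> r + (omega \<xi> r + 1) *\<^sub>R e r + (- alpha e r) *\<^sub>R f r"
    and "bracket \<xi> f r = 0 *\<^sub>R \<xi> r + (- beta f r) *\<^sub>R e r + (- omega \<xi> r - 1) *\<^sub>R f r"
    and "bracket e f r = 2 *\<^sub>R \<xi> r + (- omega f r) *\<^sub>R e r + (- omega e r) *\<^sub>R f r"
  unfolding torsion_free[OF frame_vfs(1,2) r] torsion_free[OF frame_vfs(1,3) r] torsion_free[OF frame_vfs(2,3) r]
    nabla_frame[OF frame_vfs(1) r] nabla_frame[OF frame_vfs(2) r] nabla_frame[OF frame_vfs(3) r]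
    combination_diff form_values[OF r]
  by simp_all

text \<open>The bare terms \<open>c\<close> and \<open>- b\<close> come from
  \<open>alpha f = 1\<close> and \<open>beta e = -1\<close>; \<open>a\<close> is absent from the
  first two formulas because \<open>alpha\<close> and \<open>beta\<close> vanish on
  \<open>\<xi>\<close>.\<close>

lemma forms_expand:
  assumes X: "vf W X" and q: "q \<in> W" and Xq: "X q = a *\<^sub>R \<xi> q + b *\<^sub>R e q + c *\<^sub>R f q"
  shows "alpha X q = b * alpha e q + c" "beta X q = - b + c * beta f q"
    "omega X q = a * omega \<xi> q + b * omega e q + c * omega f q"
proof -
  note p = W_topspace[OF q]
  note sub = subspace_add[OF tangent_subspace] subspace_scale[OF tangent_subspace]
  have *: "g q (nabla X Y q) (Z q) = a * g q (nabla \<xi> Y q) (Z q) + b * g q (nabla e Y q) (Z q) + c * g q (nabla f Y q) (Z q)"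
    if Y: "vf W Y" and Z: "vf W Z" for Y Z
    using nabla_expand[OF X Y subset_refl q] q p sub vf_tangent[OF nabla_vf[OF _ Y] q] frame_vfs vf_tangent[OF Z q]
    unfolding Xq g_combination[OF q] by (simp add: g_add_left g_scale_left)
  show "alpha X q = b * alpha e q + c" "beta X q = - b + c * beta f q"
    "omega X q = a * omega \<xi> q + b * omega e q + c * omega f q"
    using *[OF frame_vfs(1,2)] *[OF frame_vfs(1,3)] *[OF frame_vfs(2,3)] form_values[OF q]
    unfolding alpha_def beta_def omega_def by simp_all
qed

text \<open>Cartan's second structure equations. The quadratic terms are the products of first
  covariant derivatives in \<open>curvature_metric\<close>, evaluated in the frame.\<close>

lemma structure_equations:
  assumes X: "vf W X" and Y: "vf W Y" and q: "q \<in> W"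
  shows "Rm q (X q) (Y q) (\<xi> q) (e q) = X q (alpha Y) - Y q (alpha X) - alpha (bracket X Y) q
      - omega X q * alpha Y q + omega Y q * alpha X q"
    and "Rm q (X q) (Y q) (\<xi> q) (f q) = X q (beta Y) - Y q (beta X) - beta (bracket X Y) q
      + omega X q * beta Y q - omega Y q * beta X q"
    and "Rm q (X q) (Y q) (e q) (f q) = X q (omega Y) - Y q (omega X) - omega (bracket X Y) q
      + alpha X q * beta Y q - alpha Y q * beta X q"
proof -
  note p = W_topspace[OF q]
  have ip: "g q (nabla B \<xi> q) (nabla C e q) = omega C q * alpha B q"
      "g q (nabla B \<xi> q) (nabla C f q) = - omega C q * beta B q"
      "g q (nabla B e q) (nabla C f q) = - omega B q * omega C q + alpha B q * beta C q"
    if B: "vf W B" and C: "vf W C" for B C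
    unfolding nabla_frame[OF B q] nabla_frame[OF C q] g_combinations[OF q] by simp_all
  have m: "Rm q (X q) (Y q) (Z q) (V q) = X p (\<lambda>q. g q (nabla Y Z q) (V q)) - g p (nabla Y Z p) (nabla X V p)
    - Y p (\<lambda>q. g q (nabla X Z q) (V q)) + g p (nabla X Z p) (nabla Y V p)
    - g p (nabla (bracket X Y) Z p) (V p)" if "vf W Z" "vf W V" "p = q" for Z V p
    unfolding Rm_def curvature_at_eq[OF q X Y that(1)] that(3) using curvature_metric[OF X Y that(1,2) q] .
  show "Rm q (X q) (Y q) (\<xi> q) (e q) = X q (alpha Y) - Y q (alpha X) - alpha (bracket X Y) q
      - omega X q * alpha Y q + omega Y q * alpha X q"
    unfolding m[OF frame_vfs(1,2) refl] ip[OF X Y] ip[OF Y X] by (simp add: alpha_def)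
  show "Rm q (X q) (Y q) (\<xi> q) (f q) = X q (beta Y) - Y q (beta X) - beta (bracket X Y) q
      + omega X q * beta Y q - omega Y q * beta X q"
    unfolding m[OF frame_vfs(1,3) refl] ip[OF X Y] ip[OF Y X] by (simp add: beta_def)
  show "Rm q (X q) (Y q) (e q) (f q) = X q (omega Y) - Y q (omega X) - omega (bracket X Y) q
      + alpha X q * beta Y q - alpha Y q * beta X q"
    unfolding m[OF frame_vfs(2,3) refl] ip[OF X Y] ip[OF Y X] by (simp add: omega_def)
qed

text \<open>The directions \<open>e\<close> and \<open>f\<close> contribute equally to the trace,
  and \<open>omega \<xi>\<close> cancels between the bracket and the quadratic term.\<close>

lemma ricci_xi_xi:
  assumes q: "q \<in> W"
  shows "ricci M A nabla q (\<xi> q) (\<xi> q) = - 2 * (1 + alpha e q * beta f q)"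
proof -
  note b = bracket_vf[OF frame_vfs(2,1)] bracket_vf[OF frame_vfs(3,1)]
  have "bracket e \<xi> q = 0 *\<^sub>R \<xi> q + (- omega \<xi> q - 1) *\<^sub>R e q + alpha e q *\<^sub>R f q"
    "bracket f \<xi> q = 0 *\<^sub>R \<xi> q + beta f q *\<^sub>R e q + (omega \<xi> q + 1) *\<^sub>R f q"
    unfolding torsion_free[OF frame_vfs(2,1) q] torsion_free[OF frame_vfs(3,1) q]
      nabla_frame[OF frame_vfs(1) q] nabla_frame[OF frame_vfs(2) q] nabla_frame[OF frame_vfs(3) q]
      combination_diff form_values[OF q]
    by simp_all
  note fb = forms_expand[OF b(1) q this(1)] forms_expand[OF b(2) q this(2)]
  have d: "\<xi> q (beta e) = 0" "e q (beta \<xi>) = 0" "\<xi> q (alpha f) = 0" "f q (alpha \<xi>) = 0"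
    using derivative_of_constant[OF frame_tangent(3)[OF q] q, of _ "-1"] derivative_of_constant[OF frame_tangent(3)[OF q] q, of _ 1]
      derivative_of_constant[OF frame_tangent(1)[OF q] q, of _ 0] derivative_of_constant[OF frame_tangent(2)[OF q] q, of _ 0]
      form_values by simp_all
  have "Rm q (\<xi> q) (\<xi> q) (\<xi> q) (\<xi> q) = 0"
    using Rm_skew(1)[OF q, of "\<xi> q" "\<xi> q" "\<xi> q" "\<xi> q"] q by simp
  moreover have "Rm q (e q) (\<xi> q) (\<xi> q) (f q) = - 1 - alpha e q * beta f q"
    using structure_equations(2)[OF frame_vfs(2,1) q] fb d form_values[OF q] by (simp add: algebra_simps)
  moreover have "Rm q (f q) (\<xi> q) (\<xi> q) (e q) = - 1 - alpha e q * beta f q"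
    using structure_equations(1)[OF frame_vfs(3,1) q] fb d form_values[OF q] by (simp add: algebra_simps)
  ultimately show ?thesis
    using ricci_eq[OF q frame_tangent(3)[OF q] frame_tangent(3)[OF q]] by simp
qed

end

section \<open>Constancy of the trace\<close>

locale commuting_frame = adapted_frame M A g nabla \<phi> \<xi> \<eta> W e f
  for M :: "'a topology" and A :: "('a, 'e::euclidean_space) chart set" and g nabla \<phi> \<xi> \<eta> W e f +
  assumes commute: "\<And>p x. p \<in> topspace M \<Longrightarrow> x \<in> tangent_space M A p \<Longrightarrow>
    \<phi> p (ricci_operator M A g nabla p x) = ricci_operator M A g nabla p (\<phi> p x)"
begin

text \<open>An operator commuting with \<open>\<phi>\<close> preserves its eigenspaces and its
  kernel, so \<open>Q\<close> maps each of \<open>e\<close>, \<open>f\<close>, \<open>\<xi>\<close>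
  into its own line. These lines are orthogonal except for the pair \<open>e, f\<close>, and those
  of \<open>e\<close> and \<open>f\<close> are isotropic.\<close>

lemma ricci_vanishing:
  assumes q: "q \<in> W"
  shows "ricci M A nabla q (e q) (e q) = 0" "ricci M A nabla q (e q) (\<xi> q) = 0"
    "ricci M A nabla q (f q) (f q) = 0" "ricci M A nabla q (f q) (\<xi> q) = 0"
    "ricci M A nabla q (\<xi> q) (e q) = 0" "ricci M A nabla q (\<xi> q) (f q) = 0"
proof -
  note p = W_topspace[OF q] and sub = subspace_scale[OF tangent_subspace]
  let ?Q = "ricci_operator M A g nabla q"
  \<comment> \<open>\<open>Q\<close> is given by a \<open>THE\<close>, so homogeneity has to be
    derived; it is applied with factor -1 for \<open>\<phi> f = - f\<close> and with factor 0 for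
    \<open>\<phi> \<xi> = 0\<close>.\<close>
  have scale: "?Q (c *\<^sub>R x) = c *\<^sub>R ?Q x" if x: "x \<in> tangent q" for c x
  proof (rule g_eqI[OF p])
    fix y assume y: "y \<in> tangent q"
    show "g q (?Q (c *\<^sub>R x)) y = g q (c *\<^sub>R ?Q x) y"
      using p q x y sub ricci_operator
      by (simp add: g_scale_left ricci_eq Rm_scale2 algebra_simps)
  qed (use q x sub ricci_operator in auto)
  note Q = ricci_operator[OF q frame_tangent(1)[OF q]] ricci_operator[OF q frame_tangent(2)[OF q]]
    ricci_operator[OF q frame_tangent(3)[OF q]]
  have e: "\<phi> q (?Q (e q)) = ?Q (e q)" using commute[OF p, of "e q"] phi_e[OF q] q by simp
  show "ricci M A nabla q (e q) (e q) = 0" "ricci M A nabla q (e q) (\<xi> q) = 0"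
    using Q(2)[of "e q"] Q(2)[of "\<xi> q"] q g_eigenvectors(1)[OF p Q(1) _ e phi_e[OF q]]
      g_xi(1)[OF p Q(1)] eta_eigenvector[OF p Q(1)] e by simp_all
  have f: "\<phi> q (?Q (f q)) = - ?Q (f q)"
    using commute[OF p, of "f q"] phi_f[OF q] q scale[of "f q" "-1"] by simp
  show "ricci M A nabla q (f q) (f q) = 0" "ricci M A nabla q (f q) (\<xi> q) = 0"
    using Q(4)[of "f q"] Q(4)[of "\<xi> q"] q g_eigenvectors(2)[OF p Q(3) _ f phi_f[OF q]]
      g_xi(1)[OF p Q(3)] eta_eigenvector[OF p Q(3)] f by simp_all
  \<comment> \<open>The zero vector is written as a multiple of \<open>\<xi>\<close> so that
    \<open>phi_scale\<close> can apply \<open>\<phi>\<close> to it once more. The formula for the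
    square of \<open>\<phi>\<close> then puts \<open>Q \<xi>\<close> on the line of
    \<open>\<xi>\<close>.\<close>
  have x: "\<phi> q (?Q (\<xi> q)) = 0 *\<^sub>R \<xi> q"
    using commute[OF p, of "\<xi> q"] phi_xi[OF p] q scale[of "\<xi> q" 0] by simp
  have "?Q (\<xi> q) - \<eta> q (?Q (\<xi> q)) *\<^sub>R \<xi> q = 0"
    using phi_phi[OF p Q(5)] unfolding x using phi_scale[OF p, of "\<xi> q" 0] q by simp
  then obtain c where c: "?Q (\<xi> q) = c *\<^sub>R \<xi> q" by auto
  show "ricci M A nabla q (\<xi> q) (e q) = 0" "ricci M A nabla q (\<xi> q) (f q) = 0"
    using Q(6)[of "e q"] Q(6)[of "f q"] q p unfolding c by (simp_all add: g_scale_left)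
qed

text \<open>In the null frame each of the six Ricci entries reduces to a single curvature component
  up to sign, since the other terms repeat a vector in a skew pair. The two orders of a mixed entry
  isolate different components.\<close>

lemma Rm_vanishing:
  assumes q: "q \<in> W"
  shows "Rm q (\<xi> q) (e q) (\<xi> q) (e q) = 0" "Rm q (\<xi> q) (f q) (\<xi> q) (f q) = 0"
    "Rm q (e q) (f q) (\<xi> q) (e q) = 0" "Rm q (e q) (f q) (\<xi> q) (f q) = 0"
    "Rm q (\<xi> q) (e q) (e q) (f q) = 0" "Rm q (\<xi> q) (f q) (e q) (f q) = 0"
proof -
  note t = frame_tangent[OF q]
  note sk1 = Rm_skew(1)[OF q] and sk2 = Rm_skew(2)[OF q]
  have z: "Rm q x y z z = 0" "Rm q x x y z = 0" if "x \<in> tangent q" "y \<in> tangent q" "z \<in> tangent q" for x y z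
    using sk1[of x x y z] sk2[of x y z z] that by simp_all
  note r = ricci_vanishing[OF q, unfolded ricci_eq[OF q t(1,1)] ricci_eq[OF q t(1,3)] ricci_eq[OF q t(2,2)]
      ricci_eq[OF q t(2,3)] ricci_eq[OF q t(3,1)] ricci_eq[OF q t(3,2)]]
  show "Rm q (\<xi> q) (e q) (\<xi> q) (e q) = 0" using r(1) z t sk2[OF t(3,1,3,1)] by simp
  show "Rm q (\<xi> q) (f q) (\<xi> q) (f q) = 0" using r(3) z t sk2[OF t(3,2,3,2)] by simp
  show "Rm q (e q) (f q) (\<xi> q) (e q) = 0" using r(2) z t sk1[OF t(1,2,3,1)] by simp
  show "Rm q (e q) (f q) (\<xi> q) (f q) = 0" using r(4) z t by simp
  show "Rm q (\<xi> q) (e q) (e q) (f q) = 0" using r(5) z t sk1[OF t(3,1,1,2)] by simp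
  show "Rm q (\<xi> q) (f q) (e q) (f q) = 0"
    using r(6) z t sk1[OF t(3,2,1,2)] sk2[OF t(2,3,1,2)] by simp
qed

text \<open>Structure equations with vanishing curvature side. \<open>alpha\<close> is constant on
  \<open>\<xi>\<close> and \<open>f\<close>, so \<open>alpha e\<close> is never differentiated along
  \<open>e\<close> in them; likewise \<open>beta f\<close> never along \<open>f\<close>. Each factor
  2 collects one \<open>omega\<close> from the bracket and one from the quadratic term.\<close>

lemma form_derivatives:
  assumes q: "q \<in> W"
  shows "\<xi> q (alpha e) = 2 * (alpha e q * omega \<xi> q)"
    and "\<xi> q (beta f) = - 2 * (beta f q * omega \<xi> q)"
    and "f q (alpha e) = 2 * (alpha e q * omega f q)"
    and "e q (beta f) = - 2 * (beta f q * omega e q)"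
    and "\<xi> q (omega f) - f q (omega \<xi>) + beta f q * omega e q + (omega \<xi> q + 1) * omega f q = 0"
    and "\<xi> q (omega e) - e q (omega \<xi>) - (omega \<xi> q + 1) * omega e q + alpha e q * omega f q = 0"
proof -
  note b = bracket_vf[OF frame_vfs(1,2)] bracket_vf[OF frame_vfs(1,3)] bracket_vf[OF frame_vfs(2,3)]
  note fb = forms_expand[OF b(1) q frame_brackets(1)[OF q]] forms_expand[OF b(2) q frame_brackets(2)[OF q]]
    forms_expand[OF b(3) q frame_brackets(3)[OF q]]
  have d: "x (alpha \<xi>) = 0" "x (beta \<xi>) = 0" "x (alpha f) = 0" "x (beta e) = 0" if "x \<in> tangent q" for x
    using derivative_of_constant[OF that q, of _ 0] derivative_of_constant[OF that q, of _ 1]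
      derivative_of_constant[OF that q, of _ "-1"] form_values by simp_all
  note t = frame_tangent[OF q]
  \<comment> \<open>Three equations per pair, for \<open>alpha\<close>, \<open>beta\<close>,
    \<open>omega\<close> in turn: 1 to 3 for \<open>\<xi>, e\<close>, 4 to 6 for
    \<open>\<xi>, f\<close>, 7 to 9 for \<open>e, f\<close>.\<close>
  note S = structure_equations[OF frame_vfs(1,2) q] structure_equations[OF frame_vfs(1,3) q]
    structure_equations[OF frame_vfs(2,3) q]
  note simps = Rm_vanishing[OF q] fb d[OF t(1)] d[OF t(2)] d[OF t(3)] form_values[OF q]
  show "\<xi> q (alpha e) = 2 * (alpha e q * omega \<xi> q)" using S(1) unfolding simps by (simp add: algebra_simps)
  show "\<xi> q (beta f) = - 2 * (beta f q * omega \<xi> q)" using S(5) unfolding simps by (simp add: algebra_simps)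
  show "f q (alpha e) = 2 * (alpha e q * omega f q)" using S(7) unfolding simps by (simp add: algebra_simps)
  show "e q (beta f) = - 2 * (beta f q * omega e q)" using S(8) unfolding simps by (simp add: algebra_simps)
  show "\<xi> q (omega f) - f q (omega \<xi>) + beta f q * omega e q + (omega \<xi> q + 1) * omega f q = 0"
    using S(6) unfolding simps by (simp add: algebra_simps)
  show "\<xi> q (omega e) - e q (omega \<xi>) - (omega \<xi> q + 1) * omega e q + alpha e q * omega f q = 0"
    using S(3) unfolding simps by (simp add: algebra_simps)
qed

text \<open>With \<open>s = alpha e\<close> and \<open>t = beta f\<close>, every frame direction
  \<open>X\<close> satisfies \<open>t (X s) = 2 s t omega(X)\<close> and
  \<open>s (X t) = - 2 s t omega(X)\<close>, and the sum is zero.\<close>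

lemma product_derivative_zero:
  assumes q: "q \<in> W" and x: "x \<in> tangent q"
  shows "x (\<lambda>r. alpha e r * beta f r) = 0"
proof -
  note t = frame_tangent[OF q]
  note sm = forms_smooth(1)[OF frame_vfs(2)] forms_smooth(2)[OF frame_vfs(3)] forms_smooth(3)
  have prod: "y (\<lambda>r. alpha e r * beta f r) = alpha e q * y (beta f) + beta f q * y (alpha e)" if "y \<in> tangent q" for y
    using tangent_mult[OF that sm(1,2) q] .
  \<comment> \<open>Differentiates a first-order law once more. The law holds on \<open>W\<close>
    only, which is why \<open>tangent_cong\<close> enters.\<close>
  have der: "y (\<lambda>r. Z r h) = c * (h q * y (omega X) + omega X q * y h)"
    if y: "y \<in> tangent q" and h: "smooth W h" and X: "vf W X"
      and eq: "\<And>r. r \<in> W \<Longrightarrow> Z r h = c * (h r * omega X r)" for y h X Z c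
  proof -
    note s = smooth_mult[OF h sm(3)[OF X]]
    have "y (\<lambda>r. Z r h) = y (\<lambda>r. c * (h r * omega X r))"
      by (rule tangent_cong[OF y smooth_cmult[OF s] q, symmetric]) (use eq in simp)
    then show ?thesis
      using tangent_cmult[OF y s q] tangent_mult[OF y h sm(3)[OF X] q] by simp
  qed
  note D = form_derivatives
  have "\<xi> q (\<lambda>r. f r (alpha e)) = 2 * (alpha e q * \<xi> q (omega f) + omega f q * \<xi> q (alpha e))"
    "f q (\<lambda>r. \<xi> r (alpha e)) = 2 * (alpha e q * f q (omega \<xi>) + omega \<xi> q * f q (alpha e))"
    "\<xi> q (\<lambda>r. e r (beta f)) = (-2) * (beta f q * \<xi> q (omega e) + omega e q * \<xi> q (beta f))"
    "e q (\<lambda>r. \<xi> r (beta f)) = (-2) * (beta f q * e q (omega \<xi>) + omega \<xi> q * e q (beta f))"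
    by (rule der[OF t(3) sm(1) frame_vfs(3)], rule D, assumption)
      (rule der[OF t(2) sm(1) frame_vfs(1)], rule D, assumption,
       rule der[OF t(3) sm(2) frame_vfs(2)], rule D, assumption,
       rule der[OF t(1) sm(2) frame_vfs(1)], rule D, assumption)
  note second = this
  text \<open>The integrability conditions given by \<open>[\<xi>, f]\<close> on \<open>alpha e\<close> and \<open>[\<xi>, e]\<close> on \<open>beta f\<close>
    supply the two derivatives that the vanishing of curvature leaves open.\<close>
  have "beta f q * e q (alpha e) = 2 * alpha e q * beta f q * omega e q"
  proof -
    have "\<xi> q (\<lambda>r. f r (alpha e)) - f q (\<lambda>r. \<xi> r (alpha e)) = bracket \<xi> f q (alpha e)"
      using lie_bracket_apply[OF sm(1) q] by simp
    also have "\<dots> = - beta f q * e q (alpha e) + (- omega \<xi> q - 1) * f q (alpha e)"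
      unfolding frame_brackets[OF q] by (simp add: scaleR_fun_def)
    \<comment> \<open>On the left the products of first derivatives cancel, leaving
      \<open>2 s\<close> times \<open>\<xi> (omega f) - f (omega \<xi>)\<close>. Substituting this
      difference, the terms with \<open>omega \<xi> + 1\<close> cancel against the right
      side.\<close>
    finally show ?thesis
      using D(5)[OF q] unfolding second D(1-4)[OF q] by algebra
  qed
  moreover have "alpha e q * f q (beta f) = - 2 * alpha e q * beta f q * omega f q"
  proof -
    have "\<xi> q (\<lambda>r. e r (beta f)) - e q (\<lambda>r. \<xi> r (beta f)) = bracket \<xi> e q (beta f)"
      using lie_bracket_apply[OF sm(2) q] by simp
    also have "\<dots> = (omega \<xi> q + 1) * e q (beta f) - alpha e q * f q (beta f)"
      unfolding frame_brackets[OF q] by (simp add: scaleR_fun_def)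
    finally show ?thesis
      using D(6)[OF q] unfolding second D(1-4)[OF q] by algebra
  qed
  ultimately have "e q (\<lambda>r. alpha e r * beta f r) = 0" "f q (\<lambda>r. alpha e r * beta f r) = 0"
    "\<xi> q (\<lambda>r. alpha e r * beta f r) = 0"
    unfolding prod[OF t(1)] prod[OF t(2)] prod[OF t(3)] D(1-4)[OF q] by (simp_all add: algebra_simps)
  then have "(\<eta> q x *\<^sub>R \<xi> q + g q x (f q) *\<^sub>R e q + g q x (e q) *\<^sub>R f q) (\<lambda>r. alpha e r * beta f r) = 0"
    by (simp add: scaleR_fun_def)
  then show ?thesis using expand[OF q x] by simp
qed

end

theorem lemma4p1:
  fixes M :: "'a topology"
    and A :: "('a, real ^ 3) chart set"
    and \<phi> :: "'a \<Rightarrow> 'a tvec \<Rightarrow> 'a tvec"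
    and \<xi> :: "'a vfield"
    and \<eta> :: "'a \<Rightarrow> 'a tvec \<Rightarrow> real"
    and g :: "'a \<Rightarrow> 'a tvec \<Rightarrow> 'a tvec \<Rightarrow> real"
    and nabla :: "'a connection"
  assumes "smooth_manifold M A"
    and "connected_space M"
    and "paracontact_metric_structure M A 1 \<phi> \<xi> \<eta> g"
    and "levi_civita M A g nabla"
    and "\<forall>p\<in>topspace M. \<forall>x\<in>tangent_space M A p.
      \<phi> p (ricci_operator M A g nabla p x) = ricci_operator M A g nabla p (\<phi> p x)"
  shows "(\<lambda>p. trace_on (tangent_space M A p) (jacobi_operator M A nabla \<xi> p)) constant_on topspace M"
proof -
  interpret paracontact M A g nabla \<phi> \<xi> \<eta>
  proof
    show "pseudo_riemannian_metric M A g"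
      using assms(3) unfolding paracontact_metric_structure_def compatible_metric_def by blast
  qed (use assms in simp_all)
  define F where "F p = trace_on (tangent p) (jacobi_operator M A nabla \<xi> p)" for p
  \<comment> \<open>Frames exist only near a point, but \<open>F\<close> is defined without one, so
    any frame around \<open>p\<close> may be used.\<close>
  have loc: "\<exists>V. openin M V \<and> p \<in> V \<and> (\<forall>q\<in>V. F q = F p)" if p: "p \<in> topspace M" for p
  proof -
    obtain W e f where W: "p \<in> W" "adapted_frame M A g nabla \<phi> \<xi> \<eta> W e f"
      by (rule adapted_frame_exists[OF p])
    interpret adapted_frame M A g nabla \<phi> \<xi> \<eta> W e f by (rule W(2))
    interpret commuting_frame M A g nabla \<phi> \<xi> \<eta> W e f
      by unfold_locales (use assms(5) in blast)
    \<comment> \<open>\<open>tr l\<close> and \<open>Ric(\<xi>, \<xi>)\<close> are the same trace by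
      definition, so unfolding is enough.\<close>
    have F: "F q = - 2 * (1 + alpha e q * beta f q)" if "q \<in> W" for q
      using ricci_xi_xi[OF that] unfolding F_def ricci_def jacobi_operator_def .
    have "smooth W (\<lambda>q. alpha e q * beta f q)"
      using smooth_mult[OF forms_smooth(1)[OF e_vf] forms_smooth(2)[OF f_vf]] .
    then obtain V where V: "openin M V" "p \<in> V" "V \<subseteq> W"
      "\<And>q. q \<in> V \<Longrightarrow> alpha e q * beta f q = alpha e p * beta f p"
      by (rule locally_constant[OF _ W(1)]) (rule product_derivative_zero that; assumption)+
    have "F q = F p" if "q \<in> V" for q
      using F[OF W(1)] F[OF subsetD[OF V(3) that]] V(4)[OF that] by simp
    then show ?thesis using V(1,2) by blast
  qed
  \<comment> \<open>Local constancy makes the preimage of every set open. Applied to a one-point set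
    and to its complement it gives a set both open and closed, and connectedness decides.\<close>
  have op: "openin M {r \<in> topspace M. F r \<in> T}" for T
    unfolding openin_subopen[of M "{r \<in> topspace M. F r \<in> T}"]
  proof
    fix r assume "r \<in> {r \<in> topspace M. F r \<in> T}"
    then have r: "r \<in> topspace M" "F r \<in> T" by auto
    obtain V where V: "openin M V" "r \<in> V" "\<forall>q\<in>V. F q = F r" using loc[OF r(1)] by blast
    have "V \<subseteq> {r \<in> topspace M. F r \<in> T}"
    proof
      fix q assume q: "q \<in> V"
      then have "F q = F r" "q \<in> topspace M" using V(3) openin_subset[OF V(1)] by blast+
      then show "q \<in> {r \<in> topspace M. F r \<in> T}" using r(2) by simp
    qed
    then show "\<exists>V. openin M V \<and> r \<in> V \<and> V \<subseteq> {r \<in> topspace M. F r \<in> T}" using V(1,2) by blast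
  qed
  have "F q = F p" if p: "p \<in> topspace M" and q: "q \<in> topspace M" for p q
  proof -
    have "topspace M - {r \<in> topspace M. F r \<in> {F p}} = {r \<in> topspace M. F r \<in> - {F p}}" by auto
    then have "closedin M {r \<in> topspace M. F r \<in> {F p}}"
      unfolding closedin_def using op[of "- {F p}"] by simp
    then have "{r \<in> topspace M. F r \<in> {F p}} = {} \<or> {r \<in> topspace M. F r \<in> {F p}} = topspace M"
      using op[of "{F p}"] assms(2) unfolding connected_space_clopen_in by blast
    then show ?thesis using p q by blast
  qed
  then have "F constant_on topspace M" unfolding constant_on_def by metis
  then show ?thesis unfolding F_def .
qed

end
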